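(* Let $\mathcal{T}_0$ be a finite tree with $|\mathcal{T}_0|\ge 2$ vertices, and let $(\mathcal{T}_t)_{t\ge0}$ be the tree sequence generated from $\mathcal{T}_0$ by Algorithm-I. Then the mean hitting time $\langle\mathcal{H}_t\rangle$ of the simple random walk on $\mathcal{T}_t$ satisfies, as $t\to\infty$, $$\langle\mathcal{H}_{t}\rangle\sim|\mathcal{T}_{t}|^{\chi},\qquad \chi=1+\frac{\ln 3}{\ln 5},$$ where $\sim$ means equality of order: there are constants $0<c\le C$ (depending on $\mathcal{T}_0$) with $c\,|\mathcal{T}_t|^{\chi}\le\langle\mathcal{H}_t\rangle\le C\,|\mathcal{T}_t|^{\chi}$ for all sufficiently large $t$.
   Context: Algorithm-I: given a finite tree $\mathcal{T}_{t-1}$ ($t\ge1$), with $k_v(t-1)$ denoting the degree of vertex $v$ in $\mathcal{T}_{t-1}$, the tree $\mathcal{T}_t$ is obtained by performing two operations: (i) for each vertex $v$ of $\mathcal{T}_{t-1}$ and each edge of $\mathcal{T}_{t-1}$ incident with $v$, insert one new vertex into that edge, next to $v$; thus every edge $uv$ of $\mathcal{T}_{t-1}$ receives two new vertices and is replaced by a path $u,u',v',v$ of length $3$; (ii) for each vertex $v$ of $\mathcal{T}_{t-1}$, attach $k_v(t-1)$ new vertices as leaves to $v$. $|\mathcal{T}|$ denotes the number of vertices of a tree $\mathcal{T}$. The simple random walk moves from its current vertex $u$ to each neighbor with probability $1/\deg(u)$; the hitting time $\mathcal{H}_{u\to v}$ is the expected number of steps for the walk started at $u$ to first reach $v$ (with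 $\mathcal{H}_{u\to u}=0$). The mean hitting time of a graph with vertex set $\mathcal{V}$ is $\frac{1}{|\mathcal{V}|(|\mathcal{V}|-1)}\sum_{u,v\in\mathcal{V}}\mathcal{H}_{u\to v}$ (sum over ordered pairs); $\langle\mathcal{H}_t\rangle$ is this quantity for $\mathcal{T}_t$. *)

theory Defs
  imports
    "HOL-Probability.Probability"
    "Graph_Theory.Digraph_Component"
begin

section \<open>Finite trees\<close>

text \<open>
  Undirected simple graphs are symmetric loop-free digraphs (locale \<open>pair_graph\<close>): an edge
  \<open>uv\<close> is the pair of arcs \<open>(u, v)\<close>, \<open>(v, u)\<close>, so the degree of a vertex is its out-degree.
  The library's \<open>forest\<close> and \<open>tree\<close> count the walk \<open>u, v, u\<close> as a cycle and hence exclude every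
  symmetric digraph with an arc; cycles of an undirected graph are the directed cycles of
  length at least 3.
\<close>

definition finite_tree :: "'a pair_pre_digraph \<Rightarrow> bool" where
  "finite_tree G \<longleftrightarrow>
     pair_graph G \<and> Digraph_Component.connected (with_proj G) \<and>
     \<not> (\<exists>p. pre_digraph.cycle (with_proj G) p \<and> 3 \<le> length p)"

abbreviation degree_of :: "'a pair_pre_digraph \<Rightarrow> 'a \<Rightarrow> nat" where
  "degree_of G v \<equiv> out_degree (with_proj G) v"


section \<open>Algorithm-I\<close>

text \<open>
  One step of the algorithm, as a relation that leaves open which fresh vertices are used:
  \<open>ins u v\<close> is the vertex inserted into the edge \<open>uv\<close> next to \<open>u\<close>, and
  \<open>lf v 0, \<dots>, lf v (k - 1)\<close> are the leaves attached to \<open>v\<close>, where \<open>k\<close> is the degree of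
  \<open>v\<close> in the old graph.
\<close>

definition leaf_slots :: "'a pair_pre_digraph \<Rightarrow> ('a \<times> nat) set" where
  "leaf_slots G = (SIGMA v : pverts G. {..<degree_of G v})"

definition algorithm_I_arcs ::
  "'a pair_pre_digraph \<Rightarrow> ('a \<Rightarrow> 'a \<Rightarrow> 'a) \<Rightarrow> ('a \<Rightarrow> nat \<Rightarrow> 'a) \<Rightarrow> ('a \<times> 'a) set" where
  "algorithm_I_arcs G ins lf =
     {(u, ins u v) | u v. (u, v) \<in> parcs G} \<union>
     {(ins u v, ins v u) | u v. (u, v) \<in> parcs G} \<union>
     {(v, lf v i) | v i. (v, i) \<in> leaf_slots G}"

definition algorithm_I_step :: "'a pair_pre_digraph \<Rightarrow> 'a pair_pre_digraph \<Rightarrow> bool" where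
  "algorithm_I_step G G' \<longleftrightarrow>
     (\<exists>ins lf.
        inj_on (\<lambda>(u, v). ins u v) (parcs G) \<and>
        inj_on (\<lambda>(v, i). lf v i) (leaf_slots G) \<and>
        (\<lambda>(u, v). ins u v) ` parcs G \<inter> pverts G = {} \<and>
        (\<lambda>(v, i). lf v i) ` leaf_slots G \<inter> pverts G = {} \<and>
        (\<lambda>(u, v). ins u v) ` parcs G \<inter> (\<lambda>(v, i). lf v i) ` leaf_slots G = {} \<and>
        pverts G' =
          pverts G \<union> (\<lambda>(u, v). ins u v) ` parcs G \<union> (\<lambda>(v, i). lf v i) ` leaf_slots G \<and>
        parcs G' = algorithm_I_arcs G ins lf \<union> (algorithm_I_arcs G ins lf)\<inverse>)"

text \<open>Over an infinite vertex type the step can always be carried out.\<close>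

lemma algorithm_I_step_exists:
  fixes G :: "'a pair_pre_digraph"
  assumes inf: "infinite (UNIV :: 'a set)"
    and fin: "finite (pverts G)" "finite (parcs G)"
  shows "\<exists>G'. algorithm_I_step G G' \<and> finite (pverts G') \<and> finite (parcs G')"
proof -
  have finL: "finite (leaf_slots G)"
    unfolding leaf_slots_def using fin by auto
  let ?S = "parcs G <+> leaf_slots G"
  have "infinite (- pverts G)"
    using inf fin(1) by (simp add: Compl_eq_Diff_UNIV)
  then obtain B where B: "finite B" "card B = card ?S" "B \<subseteq> - pverts G"
    using infinite_arbitrarily_large by blast
  then obtain h where h: "bij_betw h ?S B"
    using finite_same_card_bij[of ?S B] finL fin by auto
  define ins where "ins u v = h (Inl (u, v))" for u v
  define lf where "lf v i = h (Inr (v, i))" for v i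
  have hi: "inj_on h ?S" and hB: "h ` ?S \<subseteq> - pverts G"
    using h B by (auto simp: bij_betw_def)
  define V where
    "V = pverts G \<union> (\<lambda>(u, v). ins u v) ` parcs G \<union> (\<lambda>(v, i). lf v i) ` leaf_slots G"
  define E where "E = algorithm_I_arcs G ins lf \<union> (algorithm_I_arcs G ins lf)\<inverse>"
  have 1: "inj_on (\<lambda>(u, v). ins u v) (parcs G)"
    using hi by (fastforce simp: inj_on_def ins_def)
  have 2: "inj_on (\<lambda>(v, i). lf v i) (leaf_slots G)"
    using hi by (fastforce simp: inj_on_def lf_def)
  have 3: "(\<lambda>(u, v). ins u v) ` parcs G \<inter> pverts G = {}"
    using hB by (fastforce simp: ins_def)
  have 4: "(\<lambda>(v, i). lf v i) ` leaf_slots G \<inter> pverts G = {}"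
    using hB by (fastforce simp: lf_def)
  have 5: "(\<lambda>(u, v). ins u v) ` parcs G \<inter> (\<lambda>(v, i). lf v i) ` leaf_slots G = {}"
    using hi by (fastforce simp: inj_on_def ins_def lf_def)
  have "algorithm_I_arcs G ins lf =
      (\<lambda>(u, v). (u, ins u v)) ` parcs G \<union> (\<lambda>(u, v). (ins u v, ins v u)) ` parcs G \<union>
      (\<lambda>(v, i). (v, lf v i)) ` leaf_slots G"
    unfolding algorithm_I_arcs_def by force
  then have "finite E"
    using fin finL by (simp add: E_def)
  moreover have "finite V"
    using fin finL by (simp add: V_def)
  moreover have "algorithm_I_step G \<lparr>pverts = V, parcs = E\<rparr>"
    unfolding algorithm_I_step_def
    by (intro exI[of _ ins] exI[of _ lf] conjI 1 2 3 4 5) (simp_all add: V_def E_def)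
  ultimately show ?thesis
    by (intro exI[of _ "\<lparr>pverts = V, parcs = E\<rparr>"]) simp
qed


section \<open>Simple random walk and hitting times\<close>

text \<open>
  The law of the trajectory \<open>(X\<^sub>0, X\<^sub>1, \<dots>)\<close> of the simple random walk started at \<open>u\<close> is built
  from its conditional laws by the Ionescu-Tulcea construction: \<open>X\<^sub>0 = u\<close>, and given
  \<open>X\<^sub>0, \<dots>, X\<^sub>n\<close>, the vertex \<open>X\<^bsub>n+1\<^esub>\<close> is uniform on the neighbours of \<open>X\<^sub>n\<close>.  The kernel at a
  vertex without neighbours is an arbitrary probability measure; in a tree with at least two
  vertices this does not occur along the walk.
\<close>

definition srw_kernel :: "'a pair_pre_digraph \<Rightarrow> 'a \<Rightarrow> nat \<Rightarrow> (nat \<Rightarrow> 'a) \<Rightarrow> 'a measure" where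
  "srw_kernel G u n \<omega> =
     (case n of
        0 \<Rightarrow> measure_pmf (return_pmf u)
      | Suc m \<Rightarrow> measure_pmf (pmf_of_set {w. (\<omega> m, w) \<in> parcs G}))"

lemma Ionescu_Tulcea_srw:
  fixes G :: "'a pair_pre_digraph"
  shows "Ionescu_Tulcea (srw_kernel G u) (\<lambda>_. count_space UNIV)"
proof (rule Ionescu_Tulcea.intro)
  fix i :: nat
  show "srw_kernel G u i \<in>
      measurable (PiM {0..<i} (\<lambda>_. count_space UNIV)) (subprob_algebra (count_space UNIV))"
  proof (cases i)
    case 0
    then show ?thesis
      by (auto simp: srw_kernel_def[abs_def] space_subprob_algebra
          measure_pmf.subprob_space_axioms)
  next
    case (Suc m)
    let ?K = "\<lambda>x. measure_pmf (pmf_of_set {w. (x, w) \<in> parcs G})"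
    have "(\<lambda>\<omega>. ?K (\<omega> m)) \<in>
        measurable (PiM {0..<i} (\<lambda>_. count_space UNIV)) (subprob_algebra (count_space UNIV))"
    proof (rule measurable_compose[of "\<lambda>\<omega>. \<omega> m" _ "count_space UNIV" ?K])
      show "(\<lambda>\<omega>. \<omega> m) \<in> measurable (PiM {0..<i} (\<lambda>_. count_space UNIV)) (count_space UNIV)"
        using Suc by (intro measurable_component_singleton) simp
      show "?K \<in> measurable (count_space UNIV) (subprob_algebra (count_space UNIV))"
        by (auto simp: space_subprob_algebra measure_pmf.subprob_space_axioms)
    qed
    then show ?thesis
      using Suc by (simp add: srw_kernel_def[abs_def])
  qed
next
  fix i :: nat and \<omega> :: "nat \<Rightarrow> 'a"
  assume "\<omega> \<in> space (PiM {0..<i} (\<lambda>_. count_space UNIV))"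
  show "prob_space (srw_kernel G u i \<omega>)"
    by (auto simp: srw_kernel_def measure_pmf.prob_space_axioms split: nat.split)
qed

definition srw :: "'a pair_pre_digraph \<Rightarrow> 'a \<Rightarrow> (nat \<Rightarrow> 'a) measure" where
  "srw G u =
     projective_family.lim UNIV
       (Ionescu_Tulcea.CI (srw_kernel G u) (\<lambda>_. count_space UNIV))
       (\<lambda>_. count_space UNIV)"

text \<open>The first time a trajectory is at \<open>v\<close>, \<open>\<infinity>\<close> if it never is.\<close>

definition first_hit :: "'a \<Rightarrow> (nat \<Rightarrow> 'a) \<Rightarrow> ennreal" where
  "first_hit v \<omega> = (INF n \<in> {n. \<omega> n = v}. of_nat n)"

definition hitting_time :: "'a pair_pre_digraph \<Rightarrow> 'a \<Rightarrow> 'a \<Rightarrow> ennreal" where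
  "hitting_time G u v = (\<integral>\<^sup>+ \<omega>. first_hit v \<omega> \<partial>srw G u)"

definition mean_hitting_time :: "'a pair_pre_digraph \<Rightarrow> ennreal" where
  "mean_hitting_time G =
     (\<Sum>u\<in>pverts G. \<Sum>v\<in>pverts G. hitting_time G u v) /
     of_nat (card (pverts G) * (card (pverts G) - 1))"

end

theory Submission
  imports Defs
begin

text \<open>
  The argument works for every connected graph with an edge.  As a function of its starting
  point, the hitting time of \<open>v\<close> is the least nonnegative supersolution of
  \<open>f u = 1 + (average of f over the neighbours of u)\<close> for \<open>u \<noteq> v\<close>.  Eliminating the new vertices
  from the system of the subdivided graph returns the old system with \<open>1\<close> replaced by \<open>15\<close>, so
  one step of the algorithm multiplies the hitting times between old vertices by exactly 15.
  A new vertex is adjacent to an old one, and a hitting time between neighbours is at most the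
  number of arcs (Kac), which only grows by the factor 5; hence all hitting times are
  \<open>O(15^t)\<close>.  Conversely, the descendants of each of two distinct original vertices make up a
  positive fraction of all vertices, and hitting times between the two families are at least
  of order \<open>15^t\<close>.  Since the number of vertices is of order \<open>5^t\<close>, the exponent is
  \<open>ln 15 / ln 5\<close>.
\<close>

section \<open>Hitting times as series\<close>

definition nbrs :: "'a pair_pre_digraph \<Rightarrow> 'a \<Rightarrow> 'a set" where
  "nbrs G u = {w. (u, w) \<in> parcs G}"

text \<open>The transition operator of the walk killed at \<open>v\<close>. Mass is lost on the step
  out of \<open>v\<close>, not on arrival, so \<open>f v\<close> still counts in the average at a
  neighbour of \<open>v\<close>.\<close>

definition killed_step :: "'a pair_pre_digraph \<Rightarrow> 'a \<Rightarrow> ('a \<Rightarrow> ennreal) \<Rightarrow> 'a \<Rightarrow> ennreal" where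
  "killed_step G v f x = (if x = v then 0 else \<integral>\<^sup>+ y. f y \<partial>measure_pmf (pmf_of_set (nbrs G x)))"

lemma measurable_killed:
  fixes f :: "'a \<Rightarrow> ennreal" and k n :: nat
  assumes "k < n"
  shows "(\<lambda>\<omega>. if \<forall>i<k. \<omega> i \<noteq> v then f (\<omega> k) else 0) \<in>
    borel_measurable (PiM {0..<n} (\<lambda>_. count_space UNIV))"
proof -
  have [measurable]: "(\<lambda>\<omega>. \<omega> i) \<in> measurable (PiM {0..<n} (\<lambda>_. count_space UNIV)) (count_space (UNIV :: 'a set))"
    if "i < n" for i :: nat
    using that by (intro measurable_component_singleton) simp
  have m: "Measurable.pred (PiM {0..<n} (\<lambda>_. count_space UNIV)) (\<lambda>\<omega>. \<forall>i\<in>{..<k}. \<omega> i \<noteq> v)"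
  proof (rule pred_intros_finite)
    fix i assume "i \<in> {..<k}"
    then have "i < n" using assms by simp
    then show "Measurable.pred (PiM {0..<n} (\<lambda>_. count_space UNIV)) (\<lambda>\<omega>. \<omega> i \<noteq> v)"
      by measurable
  qed simp
  have f: "(\<lambda>\<omega>. f (\<omega> k)) \<in> borel_measurable (PiM {0..<n} (\<lambda>_. count_space UNIV))"
    using assms by (intro measurable_compose[of "\<lambda>\<omega>. \<omega> k" _ "count_space UNIV" f]) simp_all
  have "(\<lambda>\<omega>. if \<forall>i\<in>{..<k}. \<omega> i \<noteq> v then f (\<omega> k) else 0) \<in>
    borel_measurable (PiM {0..<n} (\<lambda>_. count_space UNIV))"
    using m f by measurable
  then show ?thesis by (simp add: Ball_def)
qed

text \<open>The Markov property, by induction on \<open>k\<close> with \<open>f\<close> arbitrary: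
  integrating out the last coordinate replaces \<open>f\<close> by \<open>killed_step G v f\<close>
  and leaves an integral of the same shape over a path shorter by one.\<close>

lemma nn_integral_C_killed:
  fixes f :: "'a \<Rightarrow> ennreal"
  shows "(\<integral>\<^sup>+ \<omega>. (if \<forall>i<k. \<omega> i \<noteq> v then f (\<omega> k) else 0)
      \<partial>Ionescu_Tulcea.C (srw_kernel G u) (\<lambda>_. count_space UNIV) 0 (Suc k) (\<lambda>_. undefined)) =
    (killed_step G v ^^ k) f u"
proof (induction k arbitrary: f)
  interpret IT: Ionescu_Tulcea "srw_kernel G u" "\<lambda>_. count_space UNIV"
    by (rule Ionescu_Tulcea_srw)
  have u: "(\<lambda>_. undefined) \<in> space (PiM {0..<0::nat} (\<lambda>_. count_space UNIV))"
    by (simp add: space_PiM)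
  {
    case 0
    have "IT.C 0 (Suc 0) (\<lambda>_. undefined) = IT.eP 0 (\<lambda>_. undefined)"
      unfolding IT.C.simps add_0 by (rule bind_return[OF IT.measurable_eP u])
    moreover have "(\<integral>\<^sup>+ \<omega>. f (\<omega> 0) \<partial>IT.eP 0 (\<lambda>_. undefined)) = f u"
      using measurable_killed[of 0 "Suc 0" v f]
      by (subst IT.nn_integral_eP[OF u]) (simp_all add: srw_kernel_def)
    ultimately show ?case by simp
  next
    case (Suc k)
    let ?M = "\<lambda>n. PiM {0..<n} (\<lambda>_. count_space UNIV :: 'a measure)"
    let ?F = "\<lambda>\<omega>. if \<forall>i<Suc k. \<omega> i \<noteq> v then f (\<omega> (Suc k)) else 0"
    have F: "?F \<in> borel_measurable (?M (Suc (Suc k)))"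
      by (rule measurable_killed) simp
    have "(\<integral>\<^sup>+ \<omega>. ?F \<omega> \<partial>IT.C 0 (Suc (Suc k)) (\<lambda>_. undefined)) =
        (\<integral>\<^sup>+ \<omega>. (\<integral>\<^sup>+ x. ?F x \<partial>IT.eP (Suc k) \<omega>) \<partial>IT.C 0 (Suc k) (\<lambda>_. undefined))"
      unfolding IT.C.simps(2)[of 0 "Suc k"] add_0
    proof (rule nn_integral_bind[OF F])
      show "IT.eP (Suc k) \<in> measurable (IT.C 0 (Suc k) (\<lambda>_. undefined)) (subprob_algebra (?M (Suc (Suc k))))"
        unfolding measurable_cong_sets[OF IT.sets_C[OF u, of "Suc k"] refl] add_0
        by (rule IT.measurable_eP)
    qed
    also have "\<dots> = (\<integral>\<^sup>+ \<omega>. (if \<forall>i<k. \<omega> i \<noteq> v then killed_step G v f (\<omega> k) else 0)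
        \<partial>IT.C 0 (Suc k) (\<lambda>_. undefined))"
    proof (rule nn_integral_cong)
      fix \<omega> assume "\<omega> \<in> space (IT.C 0 (Suc k) (\<lambda>_. undefined))"
      then have "\<omega> \<in> space (?M (Suc k))"
        using IT.space_C[OF u, of "Suc k"] by (simp del: IT.C.simps)
      then have "(\<integral>\<^sup>+ x. ?F x \<partial>IT.eP (Suc k) \<omega>) = (\<integral>\<^sup>+ x. ?F (fun_upd \<omega> (Suc k) x) \<partial>srw_kernel G u (Suc k) \<omega>)"
        by (rule IT.nn_integral_eP[OF _ F])
      also have "\<dots> = (if \<forall>i<k. \<omega> i \<noteq> v then killed_step G v f (\<omega> k) else 0)"
      proof -
        define Q where "Q \<longleftrightarrow> (\<forall>i<k. \<omega> i \<noteq> v)"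
        \<comment> \<open>Of the constraints at times up to \<open>k\<close>, the one at time
          \<open>k\<close> is split off; it becomes the killing inside \<open>killed_step\<close>,
          while \<open>Q\<close> keeps the earlier ones.\<close>
        have "?F (fun_upd \<omega> (Suc k) x) = (if Q then if \<omega> k = v then 0 else f x else 0)" for x
          by (auto simp: less_Suc_eq Q_def)
        then show ?thesis
          unfolding Q_def[symmetric] by (simp add: srw_kernel_def killed_step_def nbrs_def)
      qed
      finally show "(\<integral>\<^sup>+ x. ?F x \<partial>IT.eP (Suc k) \<omega>) = \<dots>" .
    qed
    also have "\<dots> = (killed_step G v ^^ Suc k) f u"
      unfolding Suc.IH by (simp add: funpow_swap1)
    finally show ?case .
  }
qed

text \<open>Tail-sum formula: the hitting time is the number of times \<open>k\<close> such that
  \<open>v\<close> has not been visited up to and including time \<open>k\<close>.\<close>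

lemma first_hit_eq_suminf:
  "first_hit v \<omega> = (\<Sum>k. if \<forall>i<Suc k. \<omega> i \<noteq> v then 1 else 0)"
proof (cases "\<exists>n. \<omega> n = v")
  case True
  define n where "n = (LEAST n. \<omega> n = v)"
  have n: "\<omega> n = v" unfolding n_def using True by (rule LeastI_ex)
  have le: "n \<le> m" if "\<omega> m = v" for m unfolding n_def using that by (rule Least_le)
  have "first_hit v \<omega> = of_nat n"
    unfolding first_hit_def using n le
    by (intro antisym INF_lower INF_greatest) auto
  moreover have "(\<forall>i<Suc k. \<omega> i \<noteq> v) \<longleftrightarrow> k \<in> {..<n}" for k
    using n le by (metis le_trans less_Suc_eq_le lessThan_iff not_less)
  then have "(\<Sum>k. if \<forall>i<Suc k. \<omega> i \<noteq> v then 1 else 0) = (\<Sum>k. if k \<in> {..<n} then 1 else (0::ennreal))"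
    by simp
  then have "(\<Sum>k. if \<forall>i<Suc k. \<omega> i \<noteq> v then 1 else 0) = (of_nat n :: ennreal)"
    by (subst (asm) suminf_finite[of "{..<n}"]) auto
  ultimately show ?thesis by simp
next
  case False
  then have "(\<Sum>k. if \<forall>i<Suc k. \<omega> i \<noteq> v then 1 else 0) = (\<Sum>k. 1 :: ennreal)"
    by simp
  also have "\<dots> = top"
    by (simp add: suminf_eq_SUP ennreal_SUP_of_nat_eq_top)
  finally show ?thesis using False by (simp add: first_hit_def)
qed

text \<open>The summand for \<open>k\<close> in the tail sum depends only on the first
  \<open>k + 1\<close> coordinates, so its integral under the limit measure is one under a
  finite-dimensional law, which \<open>nn_integral_C_killed\<close> evaluates.\<close>

lemma hitting_time_eq_suminf:
  "hitting_time G u v = (\<Sum>k. (killed_step G v ^^ k) (\<lambda>x. if x = v then 0 else 1) u)"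
proof -
  interpret IT: Ionescu_Tulcea "srw_kernel G u" "\<lambda>_. count_space UNIV"
    by (rule Ionescu_Tulcea_srw)
  have srw: "srw G u = IT.PF.lim" by (simp add: srw_def)
  let ?M = "\<lambda>n. PiM {0..<n} (\<lambda>_. count_space UNIV :: 'a measure)"
  \<comment> \<open>The killed iterates only enforce avoidance of \<open>v\<close> before time
    \<open>k\<close>; the indicator \<open>?g\<close> adds the constraint at time \<open>k\<close>
    itself.\<close>
  let ?g = "\<lambda>x. if x = v then 0 else (1::ennreal)"
  let ?F = "\<lambda>k \<omega>. if \<forall>i<k. \<omega> i \<noteq> v then ?g (\<omega> k) else 0"
  have up: "IT.up_to {0..<n} = n" for n :: nat
    unfolding IT.up_to_def by (rule Least_equality) (auto simp: not_le[symmetric])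
  have F: "?F k \<in> borel_measurable (?M (Suc k))" for k by (rule measurable_killed) simp
  have Fr: "?F k (restrict \<omega> {0..<Suc k}) = ?F k \<omega>" for k \<omega> by auto
  have r: "(\<lambda>\<omega>. restrict \<omega> {0..<n}) \<in> measurable (PiM UNIV (\<lambda>_. count_space UNIV)) (?M n)" for n :: nat
    by (rule measurable_restrict_subset) simp
  have Fm: "?F k \<in> borel_measurable (srw G u)" for k
    using measurable_compose[OF r F, of k] unfolding Fr srw
    by (subst measurable_cong_sets[OF IT.PF.sets_lim refl])
  have "(\<integral>\<^sup>+ \<omega>. ?F k \<omega> \<partial>srw G u) = (killed_step G v ^^ k) ?g u" for k
  proof -
    have u: "(\<lambda>_. undefined) \<in> space (PiM {0..<0::nat} (\<lambda>_. count_space UNIV))"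
      by (simp add: space_PiM)
    have "(\<integral>\<^sup>+ \<omega>. ?F k \<omega> \<partial>srw G u) = (\<integral>\<^sup>+ \<omega>. ?F k (restrict \<omega> {0..<Suc k}) \<partial>IT.PF.lim)"
      unfolding Fr srw ..
    also have "\<dots> = (\<integral>\<^sup>+ \<omega>. ?F k \<omega> \<partial>distr IT.PF.lim (?M (Suc k)) (\<lambda>\<omega>. restrict \<omega> {0..<Suc k}))"
      using r[of "Suc k"] unfolding measurable_cong_sets[OF IT.PF.sets_lim refl, symmetric]
      by (rule nn_integral_distr[symmetric]) (simp only: measurable_distr_eq1 F)
    also have "\<dots> = (\<integral>\<^sup>+ \<omega>. ?F k \<omega> \<partial>IT.CI {0..<Suc k})"
      by (subst IT.distr_lim) simp_all
    also have "\<dots> = (\<integral>\<^sup>+ \<omega>. ?F k \<omega> \<partial>distr (IT.C 0 (Suc k) (\<lambda>_. undefined)) (?M (Suc k)) (\<lambda>f. restrict f {0..<Suc k}))"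
      unfolding IT.CI_def up ..
    also have "\<dots> = (\<integral>\<^sup>+ \<omega>. ?F k (restrict \<omega> {0..<Suc k}) \<partial>IT.C 0 (Suc k) (\<lambda>_. undefined))"
    proof (rule nn_integral_distr)
      show "(\<lambda>\<omega>. restrict \<omega> {0..<Suc k}) \<in> measurable (IT.C 0 (Suc k) (\<lambda>_. undefined)) (?M (Suc k))"
        unfolding measurable_cong_sets[OF IT.sets_C[OF u, of "Suc k"] refl]
        by (rule measurable_restrict_subset) simp
    qed (simp only: measurable_distr_eq1 F)
    also have "\<dots> = (killed_step G v ^^ k) ?g u"
      unfolding Fr by (rule nn_integral_C_killed)
    finally show ?thesis .
  qed
  moreover have "first_hit v = (\<lambda>\<omega>. \<Sum>k. ?F k \<omega>)"
    unfolding first_hit_eq_suminf[abs_def]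
    by (intro ext suminf_cong) (auto simp: less_Suc_eq)
  ultimately show ?thesis
    unfolding hitting_time_def using Fm by (simp add: nn_integral_suminf)
qed

section \<open>Hitting times on finite symmetric graphs\<close>

text \<open>By the tail-sum formula this is the expectation of the minimum of \<open>n\<close> and
  the first hitting time of \<open>v\<close>.\<close>

definition truncated_time :: "'a pair_pre_digraph \<Rightarrow> 'a \<Rightarrow> nat \<Rightarrow> 'a \<Rightarrow> ennreal" where
  "truncated_time G v n u = (\<Sum>k<n. (killed_step G v ^^ k) (\<lambda>x. if x = v then 0 else 1) u)"

lemma truncated_time_0 [simp]: "truncated_time G v 0 u = 0"
  by (simp add: truncated_time_def)

lemma truncated_time_Suc:
  "truncated_time G v (Suc n) u = (if u = v then 0 else 1 + killed_step G v (truncated_time G v n) u)"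
  by (simp add: truncated_time_def[abs_def] sum.lessThan_Suc_shift killed_step_def nn_integral_sum
      del: sum.lessThan_Suc)

lemma truncated_time_mono: "truncated_time G v n u \<le> truncated_time G v (Suc n) u"
  by (simp add: truncated_time_def)

lemma hitting_time_eq_SUP: "hitting_time G u v = (SUP n. truncated_time G v n u)"
  by (simp add: hitting_time_eq_suminf truncated_time_def suminf_eq_SUP)

lemma hitting_time_self [simp]: "hitting_time G v v = 0"
proof -
  have "truncated_time G v n v = 0" for n by (cases n) (simp_all add: truncated_time_Suc)
  then show ?thesis by (simp add: hitting_time_eq_SUP)
qed

text \<open>The first-step equation, obtained by shifting the series by one index and exchanging sum
  and integral.\<close>

lemma hitting_time_step:
  assumes "u \<noteq> v"
  shows "hitting_time G u v = 1 + killed_step G v (\<lambda>x. hitting_time G x v) u"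
proof -
  let ?a = "\<lambda>k. (killed_step G v ^^ k) (\<lambda>x. if x = v then 0 else 1)"
  have "hitting_time G u v = ?a 0 u + (\<Sum>k. ?a (Suc k) u)"
    unfolding hitting_time_eq_suminf by (subst suminf_offset[of _ 1]) (auto simp: add.commute)
  also have "\<dots> = 1 + killed_step G v (\<lambda>x. hitting_time G x v) u"
    using assms by (simp add: killed_step_def hitting_time_eq_suminf nn_integral_suminf)
  finally show ?thesis .
qed

text \<open>These properties hold for the initial tree and are preserved by every step of the
  algorithm. Nonempty neighbourhoods make the uniform law on neighbours meaningful.\<close>

locale walk_graph =
  fixes G :: "'a pair_pre_digraph"
  assumes finite_verts: "finite (pverts G)"
    and arcs_in_verts: "parcs G \<subseteq> pverts G \<times> pverts G"
    and arcs_sym: "(u, w) \<in> parcs G \<Longrightarrow> (w, u) \<in> parcs G"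
    and arcs_irrefl: "(u, u) \<notin> parcs G"
    and nbrs_nonempty: "u \<in> pverts G \<Longrightarrow> nbrs G u \<noteq> {}"
begin

abbreviation "deg u \<equiv> card (nbrs G u)"

lemma nbrs_in_verts: "w \<in> nbrs G u \<Longrightarrow> w \<in> pverts G"
  using arcs_in_verts by (auto simp: nbrs_def)

lemma finite_nbrs [simp]: "finite (nbrs G u)"
  using finite_verts nbrs_in_verts by (meson finite_subset subsetI)

lemma deg_pos: "u \<in> pverts G \<Longrightarrow> 0 < deg u"
  by (simp add: card_gt_0_iff nbrs_nonempty)

lemma arcs_eq_Sigma: "parcs G = (SIGMA u:pverts G. nbrs G u)"
  using arcs_in_verts by (auto simp: nbrs_def)

lemma finite_arcs: "finite (parcs G)"
  unfolding arcs_eq_Sigma using finite_verts by simp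

lemma sum_deg: "(\<Sum>u\<in>pverts G. deg u) = card (parcs G)"
  unfolding arcs_eq_Sigma using finite_verts by simp

text \<open>Both sides sum over arcs, which may be reversed by symmetry. This is the stationarity of
  the degree measure.\<close>

lemma sum_nbrs_swap:
  fixes f :: "'a \<Rightarrow> 'b :: comm_semiring_1"
  shows "(\<Sum>u\<in>pverts G. \<Sum>w\<in>nbrs G u. f w) = (\<Sum>w\<in>pverts G. of_nat (deg w) * f w)"
proof -
  have "(\<Sum>u\<in>pverts G. \<Sum>w\<in>nbrs G u. f w) = (\<Sum>(u, w)\<in>parcs G. f w)"
    unfolding arcs_eq_Sigma using finite_verts by (simp add: sum.Sigma)
  also have "\<dots> = (\<Sum>(w, u)\<in>parcs G. f w)"
    by (rule sum.reindex_bij_witness[of _ "\<lambda>(a, b). (b, a)" "\<lambda>(a, b). (b, a)"])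
      (auto intro: arcs_sym)
  also have "\<dots> = (\<Sum>w\<in>pverts G. \<Sum>u\<in>nbrs G w. f w)"
    unfolding arcs_eq_Sigma using finite_verts by (subst sum.Sigma) simp_all
  finally show ?thesis by simp
qed

lemma deg_killed_step:
  assumes "u \<in> pverts G" "u \<noteq> v"
  shows "of_nat (deg u) * killed_step G v f u = (\<Sum>w\<in>nbrs G u. f w)"
  using assms nbrs_nonempty[of u] deg_pos[of u]
  by (simp add: killed_step_def nn_integral_pmf_of_set ennreal_times_divide
      ennreal_mult_divide_eq mult.commute[of "of_nat _"] del: card_gt_0_iff
      flip: ennreal_of_nat_eq_real_of_nat)

section \<open>Supersolutions and first-step equations\<close>

lemma killed_step_mono:
  assumes "u \<in> pverts G" "\<And>x. x \<in> pverts G \<Longrightarrow> f x \<le> g x"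
  shows "killed_step G v f u \<le> killed_step G v g u"
proof -
  have "AE x in measure_pmf (pmf_of_set (nbrs G u)). f x \<le> g x"
    using assms nbrs_nonempty[of u] nbrs_in_verts by (auto simp: AE_measure_pmf_iff)
  then show ?thesis by (auto simp: killed_step_def intro: nn_integral_mono_AE)
qed

text \<open>The truncated times start at \<open>0\<close> and arise by iterating the monotone
  first-step operator, so by induction they stay below \<open>f\<close>; their supremum is the
  hitting time.\<close>

lemma hitting_time_le_supersolution:
  assumes super: "\<And>x. x \<in> pverts G \<Longrightarrow> x \<noteq> v \<Longrightarrow> 1 + killed_step G v f x \<le> f x"
    and u: "u \<in> pverts G"
  shows "hitting_time G u v \<le> f u"
proof -
  have "truncated_time G v n x \<le> f x" if "x \<in> pverts G" for n x
    using that
  proof (induction n arbitrary: x)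
    case (Suc n)
    have le: "1 + killed_step G v (truncated_time G v n) x \<le> 1 + killed_step G v f x"
      using Suc by (intro add_left_mono killed_step_mono)
    show ?case
      using order_trans[OF le super[of x]] Suc.prems by (cases "x = v") (simp_all add: truncated_time_Suc)
  qed simp
  then show ?thesis using u by (auto simp: hitting_time_eq_SUP intro: SUP_least)
qed

text \<open>The same criterion multiplied by the degree, so that candidates can be checked by linear
  arithmetic over the reals.\<close>

lemma hitting_time_le_real_supersolution:
  fixes f :: "'a \<Rightarrow> real"
  assumes nonneg: "\<And>x. x \<in> pverts G \<Longrightarrow> 0 \<le> f x"
    and super: "\<And>x. x \<in> pverts G \<Longrightarrow> x \<noteq> v \<Longrightarrow> deg x + (\<Sum>w\<in>nbrs G x. f w) \<le> deg x * f x"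
    and u: "u \<in> pverts G"
  shows "hitting_time G u v \<le> ennreal (f u)"
proof (rule hitting_time_le_supersolution[where f = "\<lambda>x. ennreal (f x)", OF _ u])
  fix x assume x: "x \<in> pverts G" "x \<noteq> v"
  have s: "0 \<le> f w" if "w \<in> nbrs G x" for w using nonneg nbrs_in_verts that by blast
  have "of_nat (deg x) * (1 + killed_step G v (\<lambda>x. ennreal (f x)) x) =
      of_nat (deg x) + (\<Sum>w\<in>nbrs G x. ennreal (f w))"
    by (simp add: distrib_left deg_killed_step x)
  also have "\<dots> = ennreal (deg x + (\<Sum>w\<in>nbrs G x. f w))"
    using s by (simp add: sum_ennreal sum_nonneg ennreal_of_nat_eq_real_of_nat)
  also have "\<dots> \<le> ennreal (deg x * f x)"
    using super[OF x] by (rule ennreal_leI)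
  also have "\<dots> = of_nat (deg x) * ennreal (f x)"
    using nonneg[OF x(1)] by (simp add: ennreal_mult ennreal_of_nat_eq_real_of_nat)
  finally show "1 + killed_step G v (\<lambda>x. ennreal (f x)) x \<le> ennreal (f x)"
    using deg_pos[OF x(1)] by (subst (asm) ennreal_mult_le_mult_iff) auto
qed

lemma real_hitting_time_step:
  assumes fin: "\<And>x. x \<in> pverts G \<Longrightarrow> hitting_time G x v < \<infinity>"
    and u: "u \<in> pverts G" "u \<noteq> v"
  shows "deg u * enn2real (hitting_time G u v) =
    deg u + (\<Sum>w\<in>nbrs G u. enn2real (hitting_time G w v))"
proof -
  let ?r = "\<lambda>x. enn2real (hitting_time G x v)"
  have r: "hitting_time G x v = ennreal (?r x)" if "x \<in> pverts G" for x
    using fin[OF that] by simp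
  have "ennreal (deg u * ?r u) = of_nat (deg u) * hitting_time G u v"
    using r[OF u(1)] by (simp add: ennreal_mult ennreal_of_nat_eq_real_of_nat)
  also have "\<dots> = of_nat (deg u) * (1 + killed_step G v (\<lambda>x. hitting_time G x v) u)"
    by (simp flip: hitting_time_step[OF u(2)])
  also have "\<dots> = of_nat (deg u) + (\<Sum>w\<in>nbrs G u. hitting_time G w v)"
    by (simp add: distrib_left deg_killed_step u)
  also have "\<dots> = of_nat (deg u) + (\<Sum>w\<in>nbrs G u. ennreal (?r w))"
    using r nbrs_in_verts by (intro arg_cong2[where f = plus] sum.cong) auto
  also have "\<dots> = ennreal (deg u + (\<Sum>w\<in>nbrs G u. ?r w))"
    by (simp add: sum_ennreal sum_nonneg ennreal_of_nat_eq_real_of_nat)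
  finally show ?thesis
    by (subst (asm) ennreal_inj) (simp_all add: sum_nonneg)
qed

text \<open>Stationarity of the degree measure bounds the mean return time to \<open>v\<close> by the number of
  arcs over \<open>deg v\<close>; working with the truncated times avoids assuming finiteness.\<close>

lemma hitting_time_arc_le:
  assumes "(w, v) \<in> parcs G"
  shows "hitting_time G w v \<le> of_nat (card (parcs G))"
proof -
  let ?h = "truncated_time G v"
  define S where "S n = (\<Sum>u\<in>pverts G. of_nat (deg u) * ?h n u)" for n
  define R where "R n = (\<Sum>w\<in>nbrs G v. ?h n w)" for n
  have v: "v \<in> pverts G" and w: "w \<in> nbrs G v"
    using assms arcs_in_verts arcs_sym by (auto simp: nbrs_def)
  \<comment> \<open>The first-step equations are summed with degree weights over all
    \<open>u\<close> other than \<open>v\<close>. By stationarity the neighbour sums over all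
    \<open>u\<close> give \<open>S n\<close>, and the share of \<open>u = v\<close> is
    \<open>R n\<close>.\<close>
  have step: "S (Suc n) + R n \<le> of_nat (card (parcs G)) + S n" for n
  proof -
    have "S (Suc n) = (\<Sum>u\<in>pverts G - {v}. of_nat (deg u) * ?h (Suc n) u)"
      unfolding S_def using finite_verts v by (simp add: sum.remove[of _ v] truncated_time_Suc)
    also have "\<dots> = (\<Sum>u\<in>pverts G - {v}. of_nat (deg u) + (\<Sum>w\<in>nbrs G u. ?h n w))"
      by (intro sum.cong) (auto simp: truncated_time_Suc distrib_left deg_killed_step)
    also have "\<dots> = (\<Sum>u\<in>pverts G - {v}. of_nat (deg u)) + (\<Sum>u\<in>pverts G - {v}. \<Sum>w\<in>nbrs G u. ?h n w)"
      by (rule sum.distrib)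
    finally have "S (Suc n) + R n = (\<Sum>u\<in>pverts G - {v}. of_nat (deg u)) +
        (\<Sum>u\<in>pverts G. \<Sum>w\<in>nbrs G u. ?h n w)"
      unfolding R_def using finite_verts v by (simp add: sum.remove[of _ v] ac_simps)
    also have "\<dots> \<le> (\<Sum>u\<in>pverts G. of_nat (deg u)) + S n"
      unfolding S_def sum_nbrs_swap using finite_verts by (intro add_right_mono sum_mono2) auto
    also have "(\<Sum>u\<in>pverts G. of_nat (deg u)) = (of_nat (card (parcs G)) :: ennreal)"
      by (simp flip: sum_deg)
    finally show ?thesis .
  qed
  have fin: "S n < \<infinity>" for n
  proof (induction n)
    case (Suc n)
    have "S (Suc n) \<le> of_nat (card (parcs G)) + S n"
      using step[of n] by (meson add_increasing2 order_trans zero_le order_refl)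
    also have "\<dots> < \<infinity>" using Suc by (simp add: ennreal_of_nat_eq_real_of_nat)
    finally show ?case .
  qed (simp add: S_def)
  have "?h n w \<le> of_nat (card (parcs G))" for n
  proof -
    \<comment> \<open>Monotonicity in \<open>n\<close> lets the finite quantity \<open>S n\<close>
      be cancelled from \<open>step\<close>, leaving the arc count as a bound for
      \<open>R n\<close>, of which \<open>?h n w\<close> is one summand.\<close>
    have "S n \<le> S (Suc n)"
      unfolding S_def by (intro sum_mono mult_left_mono truncated_time_mono) simp
    then have "S n + R n \<le> S n + of_nat (card (parcs G))"
      using step[of n] by (metis add.commute add_right_mono order_trans)
    then have "R n \<le> of_nat (card (parcs G))"
      using fin[of n] by (auto simp: ennreal_add_left_cancel_le)
    moreover have "?h n w \<le> R n"
      unfolding R_def using w by (intro member_le_sum) auto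
    ultimately show ?thesis by (rule order_trans[rotated])
  qed
  then show ?thesis by (auto simp: hitting_time_eq_SUP intro: SUP_least)
qed

text \<open>The minimum \<open>?f\<close> is a supersolution for the target \<open>v\<close>. Away
  from \<open>w\<close> both arguments satisfy the first-step equation; at \<open>w\<close> they
  coincide, and the one for \<open>v\<close> suffices.\<close>

lemma hitting_time_triangle:
  assumes u: "u \<in> pverts G"
  shows "hitting_time G u v \<le> hitting_time G u w + hitting_time G w v"
proof -
  let ?f = "\<lambda>x. min (hitting_time G x v) (hitting_time G x w + hitting_time G w v)"
  have "hitting_time G u v \<le> ?f u"
  proof (rule hitting_time_le_supersolution[where f = ?f, OF _ u])
    fix x assume x: "x \<in> pverts G" "x \<noteq> v"
    have "1 + killed_step G v ?f x \<le> 1 + killed_step G v (\<lambda>x. hitting_time G x v) x"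
      by (intro add_left_mono killed_step_mono x) simp
    then have 1: "1 + killed_step G v ?f x \<le> hitting_time G x v"
      by (simp flip: hitting_time_step[OF x(2)])
    have "1 + killed_step G v ?f x \<le> hitting_time G x w + hitting_time G w v"
    proof (cases "x = w")
      case True
      then show ?thesis using 1 by simp
    next
      case False
      have "killed_step G v ?f x \<le> killed_step G v (\<lambda>x. hitting_time G x w + hitting_time G w v) x"
        by (intro killed_step_mono x) simp
      also have "\<dots> = killed_step G w (\<lambda>x. hitting_time G x w) x + hitting_time G w v"
        using x False by (simp add: killed_step_def nn_integral_add)
      finally have "1 + killed_step G v ?f x \<le>
          1 + (killed_step G w (\<lambda>x. hitting_time G x w) x + hitting_time G w v)"
        by (rule add_left_mono)
      then show ?thesis by (simp add: hitting_time_step[OF False] add.assoc)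
    qed
    with 1 show "1 + killed_step G v ?f x \<le> ?f x" by simp
  qed
  then show ?thesis by simp
qed

lemma hitting_time_ge_1:
  assumes "u \<noteq> v"
  shows "1 \<le> hitting_time G u v"
  by (simp add: hitting_time_step[OF assms])

text \<open>Along a path the triangle inequality adds up the finite bounds for single arcs.\<close>

lemma hitting_time_rtrancl_finite:
  assumes "(u, v) \<in> (parcs G)\<^sup>*" "v \<in> pverts G"
  shows "hitting_time G u v < \<infinity>"
  using assms(1)
proof (induction rule: converse_rtrancl_induct)
  case (step x y)
  have "hitting_time G x v \<le> hitting_time G x y + hitting_time G y v"
    using step(1) arcs_in_verts by (intro hitting_time_triangle) auto
  also have "\<dots> \<le> of_nat (card (parcs G)) + hitting_time G y v"
    by (intro add_right_mono hitting_time_arc_le step)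
  also have "\<dots> < \<infinity>" using step by (simp add: ennreal_of_nat_eq_real_of_nat)
  finally show ?case .
qed simp

end

section \<open>One step of the algorithm\<close>

lemma mem_nbrs: "w \<in> nbrs G u \<longleftrightarrow> (u, w) \<in> parcs G"
  by (simp add: nbrs_def)

lemma degree_of_eq_card_nbrs: "degree_of G u = card (nbrs G u)"
proof -
  have "out_arcs (with_proj G) u = Pair u ` nbrs G u"
    by (auto simp: out_arcs_def nbrs_def)
  then show ?thesis by (simp add: out_degree_def card_image inj_on_def)
qed

section \<open>Neighbourhoods and degrees in the new graph\<close>

locale algorithm_I = walk_graph G for G :: "'a pair_pre_digraph" +
  fixes G' :: "'a pair_pre_digraph" and ins :: "'a \<Rightarrow> 'a \<Rightarrow> 'a" and lf :: "'a \<Rightarrow> nat \<Rightarrow> 'a"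
  assumes ins_inj: "inj_on (\<lambda>(u, v). ins u v) (parcs G)"
    and lf_inj: "inj_on (\<lambda>(v, i). lf v i) (leaf_slots G)"
    and ins_new: "(\<lambda>(u, v). ins u v) ` parcs G \<inter> pverts G = {}"
    and lf_new: "(\<lambda>(v, i). lf v i) ` leaf_slots G \<inter> pverts G = {}"
    and ins_lf: "(\<lambda>(u, v). ins u v) ` parcs G \<inter> (\<lambda>(v, i). lf v i) ` leaf_slots G = {}"
    and verts': "pverts G' =
          pverts G \<union> (\<lambda>(u, v). ins u v) ` parcs G \<union> (\<lambda>(v, i). lf v i) ` leaf_slots G"
    and arcs': "parcs G' = algorithm_I_arcs G ins lf \<union> (algorithm_I_arcs G ins lf)\<inverse>"
begin

lemma leaf_slots_eq: "leaf_slots G = (SIGMA v:pverts G. {..<deg v})"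
  by (simp add: leaf_slots_def degree_of_eq_card_nbrs)

lemma ins_eq_iff:
  "(u, w) \<in> parcs G \<Longrightarrow> (x, y) \<in> parcs G \<Longrightarrow> ins u w = ins x y \<longleftrightarrow> u = x \<and> w = y"
  using ins_inj by (fastforce simp: inj_on_def)

lemma lf_eq_iff:
  "(v, i) \<in> leaf_slots G \<Longrightarrow> (x, j) \<in> leaf_slots G \<Longrightarrow> lf v i = lf x j \<longleftrightarrow> v = x \<and> i = j"
  using lf_inj by (fastforce simp: inj_on_def)

lemma ins_not_old: "(u, w) \<in> parcs G \<Longrightarrow> ins u w \<notin> pverts G"
  using ins_new by fastforce

lemma lf_not_old: "(v, i) \<in> leaf_slots G \<Longrightarrow> lf v i \<notin> pverts G"
  using lf_new by fastforce

lemma ins_neq_lf: "(u, w) \<in> parcs G \<Longrightarrow> (v, i) \<in> leaf_slots G \<Longrightarrow> ins u w \<noteq> lf v i"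
  using ins_lf by fastforce

lemma arc_verts: "(u, w) \<in> parcs G \<Longrightarrow> u \<in> pverts G \<and> w \<in> pverts G"
  using arcs_in_verts by blast

lemma slot_vert: "(v, i) \<in> leaf_slots G \<Longrightarrow> v \<in> pverts G"
  by (simp add: leaf_slots_def)

lemma arc'_iff:
  "(x, y) \<in> parcs G' \<longleftrightarrow>
     (\<exists>u w. (u, w) \<in> parcs G \<and> (x = u \<and> y = ins u w \<or> x = ins u w \<and> y = u)) \<or>
     (\<exists>u w. (u, w) \<in> parcs G \<and> (x = ins u w \<and> y = ins w u \<or> x = ins w u \<and> y = ins u w)) \<or>
     (\<exists>v i. (v, i) \<in> leaf_slots G \<and> (x = v \<and> y = lf v i \<or> x = lf v i \<and> y = v))"
  by (auto simp: arcs' algorithm_I_arcs_def)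

lemma nbrs'_old:
  assumes "u \<in> pverts G"
  shows "nbrs G' u = ins u ` nbrs G u \<union> lf u ` {..<deg u}"
proof -
  have "(u, x) \<in> parcs G' \<longleftrightarrow>
      (\<exists>w. (u, w) \<in> parcs G \<and> x = ins u w) \<or> (\<exists>i. (u, i) \<in> leaf_slots G \<and> x = lf u i)" for x
  proof
    assume "(u, x) \<in> parcs G'"
    then show "(\<exists>w. (u, w) \<in> parcs G \<and> x = ins u w) \<or> (\<exists>i. (u, i) \<in> leaf_slots G \<and> x = lf u i)"
      unfolding arc'_iff using assms ins_not_old lf_not_old arcs_sym by auto
  qed (use arc'_iff in blast)
  then show ?thesis using assms by (auto simp: mem_nbrs leaf_slots_eq)
qed

lemma nbrs'_ins:
  assumes "(u, w) \<in> parcs G"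
  shows "nbrs G' (ins u w) = {u, ins w u}"
proof -
  have "(ins u w, x) \<in> parcs G' \<longleftrightarrow> x = u \<or> x = ins w u" for x
  proof
    assume "(ins u w, x) \<in> parcs G'"
    then show "x = u \<or> x = ins w u"
      unfolding arc'_iff
      using ins_eq_iff[OF assms] ins_not_old[OF assms] ins_neq_lf[OF assms] arc_verts slot_vert arcs_sym
      by (elim disjE exE conjE) metis+
  qed (use assms arc'_iff in blast)
  then show ?thesis by (intro set_eqI) (simp add: mem_nbrs)
qed

lemma nbrs'_lf:
  assumes "(v, i) \<in> leaf_slots G"
  shows "nbrs G' (lf v i) = {v}"
proof -
  have "(lf v i, x) \<in> parcs G' \<longleftrightarrow> x = v" for x
  proof
    assume "(lf v i, x) \<in> parcs G'"
    then show "x = v"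
      unfolding arc'_iff
      using lf_eq_iff[OF assms] lf_not_old[OF assms] ins_neq_lf[OF _ assms] arc_verts slot_vert arcs_sym
      by (elim disjE exE conjE) metis+
  qed (use assms arc'_iff in blast)
  then show ?thesis by (intro set_eqI) (simp add: mem_nbrs)
qed

lemma verts'_cases:
  assumes "x \<in> pverts G'"
  obtains (old) "x \<in> pverts G" | (ins) u w where "(u, w) \<in> parcs G" "x = ins u w"
    | (lf) v i where "(v, i) \<in> leaf_slots G" "x = lf v i"
  using assms unfolding verts' by auto

lemma ins_in_verts': "(u, w) \<in> parcs G \<Longrightarrow> ins u w \<in> pverts G'"
  unfolding verts' by force

lemma lf_in_verts': "(v, i) \<in> leaf_slots G \<Longrightarrow> lf v i \<in> pverts G'"
  unfolding verts' by force

lemma old_in_verts': "u \<in> pverts G \<Longrightarrow> u \<in> pverts G'"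
  unfolding verts' by simp

lemma sum_nbrs'_old:
  fixes f :: "'a \<Rightarrow> 'b :: comm_monoid_add"
  assumes "u \<in> pverts G"
  shows "(\<Sum>x\<in>nbrs G' u. f x) = (\<Sum>w\<in>nbrs G u. f (ins u w)) + (\<Sum>i<deg u. f (lf u i))"
proof -
  have 1: "inj_on (ins u) (nbrs G u)"
    by (rule inj_onI) (auto simp: nbrs_def ins_eq_iff)
  have 2: "inj_on (lf u) {..<deg u}"
    using assms by (intro inj_onI) (auto simp: leaf_slots_eq lf_eq_iff)
  have 3: "ins u ` nbrs G u \<inter> lf u ` {..<deg u} = {}"
    using assms ins_neq_lf by (auto simp: nbrs_def leaf_slots_eq)
  show ?thesis
    unfolding nbrs'_old[OF assms] using 3
    by (subst sum.union_disjoint) (simp_all add: sum.reindex 1 2)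
qed

lemma deg'_old: "u \<in> pverts G \<Longrightarrow> card (nbrs G' u) = 2 * deg u"
  using sum_nbrs'_old[of u "\<lambda>_. 1 :: nat"] by simp

lemma ins_swap_neq: "(u, w) \<in> parcs G \<Longrightarrow> ins w u \<noteq> ins u w"
  using ins_eq_iff[of w u u w] arcs_sym[of u w] arcs_irrefl by auto

lemma ins_swap_not_old: "(u, w) \<in> parcs G \<Longrightarrow> u \<noteq> ins w u"
  using ins_not_old[of w u] arcs_sym[of u w] arc_verts[of u w] by auto

lemma deg'_ins: "(u, w) \<in> parcs G \<Longrightarrow> card (nbrs G' (ins u w)) = 2"
  using ins_swap_not_old[of u w] by (simp add: nbrs'_ins card_insert_if)

lemma deg'_lf: "(v, i) \<in> leaf_slots G \<Longrightarrow> card (nbrs G' (lf v i)) = 1"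
  by (simp add: nbrs'_lf)

sublocale step: walk_graph G'
proof
  show "finite (pverts G')"
    unfolding verts' leaf_slots_eq using finite_verts finite_arcs
    by (intro finite_UnI finite_imageI finite_SigmaI) auto
  show "parcs G' \<subseteq> pverts G' \<times> pverts G'"
  proof (rule subrelI)
    fix x y assume "(x, y) \<in> parcs G'"
    then show "(x, y) \<in> pverts G' \<times> pverts G'"
      using arc_verts arcs_sym slot_vert old_in_verts' ins_in_verts' lf_in_verts'
      unfolding arc'_iff mem_Times_iff fst_conv snd_conv
      by (elim disjE exE conjE) (intro conjI; metis)+
  qed
  show "(w, u) \<in> parcs G'" if "(u, w) \<in> parcs G'" for u w
    using that unfolding arcs' by blast
  show "(u, u) \<notin> parcs G'" for u
  proof
    assume "(u, u) \<in> parcs G'"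
    then show False
      using ins_not_old lf_not_old arc_verts slot_vert ins_swap_neq arcs_sym
      unfolding arc'_iff by (elim disjE exE conjE) metis+
  qed
  show "nbrs G' u \<noteq> {}" if "u \<in> pverts G'" for u
    using that by (cases rule: verts'_cases) (use nbrs_nonempty in \<open>auto simp: nbrs'_old nbrs'_ins nbrs'_lf\<close>)
qed

section \<open>Descendants of a set of vertices\<close>

definition children :: "'a set \<Rightarrow> 'a set" where
  "children U = U \<union> (\<lambda>(u, w). ins u w) ` Sigma U (nbrs G) \<union>
     (\<lambda>(v, i). lf v i) ` (SIGMA v:U. {..<deg v})"

lemma children_verts: "children (pverts G) = pverts G'"
  unfolding children_def verts' leaf_slots_eq arcs_eq_Sigma ..

lemma children_mono: "U \<subseteq> W \<Longrightarrow> children U \<subseteq> children W"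
  unfolding children_def by (intro Un_mono image_mono Sigma_mono) auto

text \<open>Every new vertex belongs to the old vertex it was placed next to, so the sum splits by
  parents. Taking \<open>f\<close> constantly \<open>1\<close> counts vertices, taking the new
  degree gives degree sums.\<close>

lemma sum_children:
  fixes f :: "'a \<Rightarrow> 'b :: comm_monoid_add"
  assumes "U \<subseteq> pverts G"
  shows "(\<Sum>x\<in>children U. f x) =
    (\<Sum>u\<in>U. f u + (\<Sum>w\<in>nbrs G u. f (ins u w)) + (\<Sum>i<deg u. f (lf u i)))"
proof -
  let ?A = "Sigma U (nbrs G)" and ?L = "SIGMA v:U. {..<deg v}"
  have U: "finite U" using assms finite_verts by (rule finite_subset)
  have A: "?A \<subseteq> parcs G" and L: "?L \<subseteq> leaf_slots G"
    using assms by (auto simp: nbrs_def leaf_slots_eq)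
  have 1: "U \<inter> (\<lambda>(u, w). ins u w) ` ?A = {}"
    and 2: "(U \<union> (\<lambda>(u, w). ins u w) ` ?A) \<inter> (\<lambda>(v, i). lf v i) ` ?L = {}"
    using assms A L ins_new lf_new ins_lf by blast+
  have "(\<Sum>x\<in>children U. f x) = (\<Sum>u\<in>U. f u) + (\<Sum>(u, w)\<in>?A. f (ins u w)) + (\<Sum>(v, i)\<in>?L. f (lf v i))"
    unfolding children_def using U 1 2 inj_on_subset[OF ins_inj A] inj_on_subset[OF lf_inj L]
    by (simp add: sum.union_disjoint sum.reindex case_prod_beta')
  also have "\<dots> = (\<Sum>u\<in>U. f u) + (\<Sum>u\<in>U. \<Sum>w\<in>nbrs G u. f (ins u w)) + (\<Sum>u\<in>U. \<Sum>i<deg u. f (lf u i))"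
    using U by (simp add: sum.Sigma)
  finally show ?thesis by (simp add: sum.distrib)
qed

lemma card_children:
  assumes "U \<subseteq> pverts G"
  shows "card (children U) = card U + 2 * (\<Sum>u\<in>U. deg u)"
  using sum_children[OF assms, of "\<lambda>_. 1 :: nat"] by (simp add: sum.distrib mult_2 sum_Suc)

lemma degree_sum_children:
  assumes "U \<subseteq> pverts G"
  shows "(\<Sum>x\<in>children U. step.deg x) = 5 * (\<Sum>u\<in>U. deg u)"
proof -
  \<comment> \<open>Each unit of old degree yields 2 at the old vertex, 2 at an inserted vertex and
    1 at a leaf, hence the factor 5.\<close>
  have "(\<Sum>x\<in>children U. step.deg x) = (\<Sum>u\<in>U. 2 * deg u + (\<Sum>w\<in>nbrs G u. 2) + (\<Sum>i<deg u. 1))"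
    unfolding sum_children[OF assms] using assms
    by (intro sum.cong arg_cong2[where f = plus])
      (auto simp: deg'_old deg'_ins deg'_lf leaf_slots_eq mem_nbrs subsetD)
  also have "\<dots> = 5 * (\<Sum>u\<in>U. deg u)" by (simp add: sum_distrib_left)
  finally show ?thesis .
qed

lemma card_arcs': "card (parcs G') = 5 * card (parcs G)"
  using degree_sum_children[of "pverts G"] unfolding children_verts sum_deg step.sum_deg by simp

lemma card_verts': "card (pverts G') = card (pverts G) + 2 * card (parcs G)"
  using card_children[of "pverts G"] unfolding children_verts sum_deg by simp

lemma children_parent:
  assumes "x \<in> children U" "U \<subseteq> pverts G"
  obtains u where "u \<in> U" "x = u \<or> (u, x) \<in> parcs G' \<and> (x, u) \<in> parcs G'"
  using assms(1)[unfolded children_def]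
proof (elim UnE imageE SigmaE)
  fix p u w
  assume x: "x = (case p of (u, w) \<Rightarrow> ins u w)" "p = (u, w)" and u: "u \<in> U" "w \<in> nbrs G u"
  have "(x, u) \<in> parcs G'"
    using x u nbrs'_ins[of u w] mem_nbrs[of u G' x] by (simp add: mem_nbrs)
  then show thesis using that[OF u(1)] step.arcs_sym[of x u] by simp
next
  fix p u i
  assume x: "x = (case p of (v, i) \<Rightarrow> lf v i)" "p = (u, i)" and u: "u \<in> U" "i \<in> {..<deg u}"
  have "(x, u) \<in> parcs G'"
    using x u nbrs'_lf[of u i] mem_nbrs[of u G' x] assms(2) by (auto simp: leaf_slots_eq)
  then show thesis using that[OF u(1)] step.arcs_sym[of x u] by simp
qed (use that in blast)

lemma hitting_time_child_le:
  assumes "x = u \<or> (u, x) \<in> parcs G' \<and> (x, u) \<in> parcs G'"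
  shows "hitting_time G' u x \<le> of_nat (card (parcs G'))"
    and "hitting_time G' x u \<le> of_nat (card (parcs G'))"
  using assms by (auto intro: step.hitting_time_arc_le)

section \<open>Decimation of hitting times between old vertices\<close>

context
  fixes v
  assumes v: "v \<in> pverts G"
begin

text \<open>The values at the new vertices are the ones that solve the first-step equations there, given
  \<open>15\<close> times the old hitting times at the old vertices.\<close>

definition lifted_time :: "'a \<Rightarrow> real" where
  "lifted_time x = (let r = \<lambda>u. enn2real (hitting_time G u v) in
     if x \<in> pverts G then 15 * r x
     else if x \<in> (\<lambda>(u, w). ins u w) ` parcs G then
       case inv_into (parcs G) (\<lambda>(u, w). ins u w) x of (u, w) \<Rightarrow> 10 * r u + 5 * r w + 2
     else case inv_into (leaf_slots G) (\<lambda>(v, i). lf v i) x of (u, i) \<Rightarrow> 15 * r u + 1)"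

lemma lifted_time_old: "u \<in> pverts G \<Longrightarrow> lifted_time u = 15 * enn2real (hitting_time G u v)"
  by (simp add: lifted_time_def)

text \<open>The inserted vertex lies one third of the way from \<open>u\<close> to \<open>w\<close>:
  the value is the linear interpolation of the end values \<open>15 * r u\<close> and
  \<open>15 * r w\<close>, plus 2, the mean exit time from that position on a path of length
  3.\<close>

lemma lifted_time_ins:
  assumes "(u, w) \<in> parcs G"
  shows "lifted_time (ins u w) =
    10 * enn2real (hitting_time G u v) + 5 * enn2real (hitting_time G w v) + 2"
  using inv_into_f_f[OF ins_inj assms] ins_not_old[OF assms] imageI[OF assms, of "\<lambda>(u, w). ins u w"]
  by (simp add: lifted_time_def)

lemma lifted_time_lf:
  assumes "(u, i) \<in> leaf_slots G"
  shows "lifted_time (lf u i) = 15 * enn2real (hitting_time G u v) + 1"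
proof -
  have "lf u i \<notin> (\<lambda>(u, w). ins u w) ` parcs G"
    by (auto simp: ins_neq_lf[OF _ assms, symmetric])
  then show ?thesis
    using inv_into_f_f[OF lf_inj assms] lf_not_old[OF assms] by (simp add: lifted_time_def)
qed

lemma hitting_time_decimation_le:
  assumes fin: "\<And>x. x \<in> pverts G \<Longrightarrow> hitting_time G x v < \<infinity>"
    and u: "u \<in> pverts G'"
  shows "hitting_time G' u v \<le> ennreal (lifted_time u)"
proof (rule step.hitting_time_le_real_supersolution[OF _ _ u])
  let ?r = "\<lambda>u. enn2real (hitting_time G u v)"
  show "0 \<le> lifted_time x" if "x \<in> pverts G'" for x
    using that by (cases rule: verts'_cases)
      (auto simp: lifted_time_old lifted_time_ins lifted_time_lf)
  show "step.deg x + (\<Sum>w\<in>nbrs G' x. lifted_time w) \<le> step.deg x * lifted_time x"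
    if x: "x \<in> pverts G'" "x \<noteq> v" for x
    using x(1)
  proof (cases rule: verts'_cases)
    case old
    have "(\<Sum>w\<in>nbrs G' x. lifted_time w) =
        (\<Sum>w\<in>nbrs G x. 10 * ?r x + 5 * ?r w + 2) + (\<Sum>i<deg x. 15 * ?r x + 1)"
      unfolding sum_nbrs'_old[OF old] using old
      by (intro arg_cong2[where f = plus] sum.cong)
        (auto simp: lifted_time_ins lifted_time_lf mem_nbrs leaf_slots_eq)
    also have "\<dots> = 5 * (\<Sum>w\<in>nbrs G x. ?r w) + deg x * (25 * ?r x + 3)"
      by (simp add: sum.distrib algebra_simps flip: sum_distrib_left)
    \<comment> \<open>Inserting the old first-step equation turns the left side into
      \<open>30 * deg x * ?r x\<close>, which is the new degree \<open>2 * deg x\<close> times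
      \<open>15 * ?r x\<close>; the factor 15 makes this an equality.\<close>
    also have "(\<Sum>w\<in>nbrs G x. ?r w) = deg x * ?r x - deg x"
      using real_hitting_time_step[OF fin old x(2)] by simp
    finally show ?thesis
      using old by (simp add: deg'_old lifted_time_old algebra_simps)
  next
    case (ins u w)
    have "ins w u \<noteq> u"
      using ins ins_not_old arcs_sym arc_verts by metis
    then show ?thesis
      using ins arc_verts[OF ins(1)] arcs_sym[OF ins(1)]
      by (simp add: deg'_ins) (simp add: nbrs'_ins lifted_time_ins lifted_time_old)
  next
    case (lf u i)
    then show ?thesis
      using slot_vert[OF lf(1)] by (simp add: deg'_lf nbrs'_lf lifted_time_lf lifted_time_old)
  qed
qed

lemma hitting_time_step_finite:
  assumes fin: "\<And>x. x \<in> pverts G \<Longrightarrow> hitting_time G x v < \<infinity>"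
    and u: "u \<in> pverts G'"
  shows "hitting_time G' u v < \<infinity>"
  using hitting_time_decimation_le[OF assms] by (simp add: order_le_less_trans)

text \<open>Supersolutions only bound from above, so the lower bound on the new times uses
  minimality in the old graph: the new times restricted to old vertices and divided by 15 solve the
  old system.\<close>

lemma hitting_time_decimation_ge:
  assumes fin': "\<And>x. x \<in> pverts G' \<Longrightarrow> hitting_time G' x v < \<infinity>"
    and u: "u \<in> pverts G"
  shows "hitting_time G u v \<le> ennreal (enn2real (hitting_time G' u v) / 15)"
proof (rule hitting_time_le_real_supersolution[where f = "\<lambda>u. enn2real (hitting_time G' u v) / 15", OF _ _ u])
  let ?r = "\<lambda>u. enn2real (hitting_time G' u v)"
  fix x assume x: "x \<in> pverts G" "x \<noteq> v"
  have ins1: "2 * ?r (ins a b) = 2 + ?r a + ?r (ins b a)" if "(a, b) \<in> parcs G" for a b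
  proof -
    have "ins a b \<noteq> v" "ins b a \<noteq> a"
      using that ins_not_old arcs_sym arc_verts v by metis+
    then show ?thesis
      using step.real_hitting_time_step[OF fin' ins_in_verts'[OF that]] that
      by (simp add: deg'_ins) (simp add: nbrs'_ins)
  qed
  \<comment> \<open>The equations at the two inserted vertices of an edge form a two-by-two linear
    system, solved here in terms of the end values.\<close>
  have ins: "?r (ins x w) = 2 + 2 / 3 * ?r x + ?r w / 3" if "w \<in> nbrs G x" for w
    using ins1[of x w] ins1[of w x] that arcs_sym[of x w] by (simp add: mem_nbrs)
  have lf: "?r (lf x i) = 1 + ?r x" if "i < deg x" for i
  proof -
    have i: "(x, i) \<in> leaf_slots G" using x that by (simp add: leaf_slots_eq)
    then have "lf x i \<noteq> v" using lf_not_old v by metis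
    then show ?thesis
      using step.real_hitting_time_step[OF fin' lf_in_verts'[OF i]] i by (simp add: deg'_lf nbrs'_lf)
  qed
  have "2 * deg x * ?r x = 2 * deg x + (\<Sum>w\<in>nbrs G' x. ?r w)"
    using step.real_hitting_time_step[OF fin' old_in_verts'[OF x(1)] x(2)] deg'_old[OF x(1)] by simp
  also have "(\<Sum>w\<in>nbrs G' x. ?r w) = (\<Sum>w\<in>nbrs G x. 2 + 2 / 3 * ?r x + ?r w / 3) + (\<Sum>i<deg x. 1 + ?r x)"
    unfolding sum_nbrs'_old[OF x(1)] by (intro arg_cong2[where f = plus] sum.cong) (auto simp: ins lf)
  also have "\<dots> = deg x * (3 + 5 / 3 * ?r x) + (\<Sum>w\<in>nbrs G x. ?r w) / 3"
    by (simp add: sum.distrib algebra_simps flip: sum_divide_distrib)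
  \<comment> \<open>Per unit of degree the constants are 2 from the equation at \<open>x\<close>, 2
    from the inserted vertex and 1 from the leaf; clearing the factor \<open>1 / 3\<close> turns
    their sum 5 into 15.\<close>
  finally have "15 * deg x + (\<Sum>w\<in>nbrs G x. ?r w) = deg x * ?r x"
    by (simp add: algebra_simps)
  then show "deg x + (\<Sum>w\<in>nbrs G x. ?r w / 15) \<le> deg x * (?r x / 15)"
    by (simp flip: sum_divide_distrib)
qed simp

lemma hitting_time_decimation:
  assumes fin: "\<And>x. x \<in> pverts G \<Longrightarrow> hitting_time G x v < \<infinity>"
    and u: "u \<in> pverts G"
  shows "hitting_time G' u v = 15 * hitting_time G u v"
proof -
  define r r' where "r = enn2real (hitting_time G u v)" and "r' = enn2real (hitting_time G' u v)"
  have r: "hitting_time G u v = ennreal r" "0 \<le> r"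
    using fin[OF u] by (simp_all add: r_def)
  have r': "hitting_time G' u v = ennreal r'" "0 \<le> r'"
    using hitting_time_step_finite[OF fin old_in_verts'[OF u]] by (simp_all add: r'_def)
  have "r' \<le> 15 * r"
    using hitting_time_decimation_le[OF fin old_in_verts'[OF u]] r r' u
    by (simp add: lifted_time_old)
  moreover have "r \<le> r' / 15"
    using hitting_time_decimation_ge[OF hitting_time_step_finite[OF fin] u] r r' by simp
  ultimately have "r' = 15 * r" by simp
  then show ?thesis using r r' by (simp add: ennreal_mult)
qed

end

end

lemma algorithm_I_stepE:
  assumes "walk_graph G" "algorithm_I_step G G'"
  obtains ins lf where "algorithm_I G G' ins lf"
  using assms(2) unfolding algorithm_I_step_def
  by (elim exE conjE) (rule that, rule algorithm_I.intro[OF assms(1)], rule algorithm_I_axioms.intro)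

lemma ennreal_mult_3: "2 * a + a = 3 * (a :: ennreal)"
  using distrib_right[of 2 1 a] by simp

section \<open>Transfer of bounds through one step\<close>

context algorithm_I
begin

text \<open>Travel from \<open>x\<close> to its parent \<open>u\<close>, on to \<open>v\<close>,
  then to \<open>y\<close>. The middle leg is an old hitting time scaled by 15, and each outer leg
  costs at most the number of arcs.\<close>

lemma hitting_time_children_le:
  assumes fin: "\<And>u v. u \<in> pverts G \<Longrightarrow> v \<in> pverts G \<Longrightarrow> hitting_time G u v < \<infinity>"
    and uv: "u \<in> pverts G" "v \<in> pverts G"
    and x: "x = u \<or> (u, x) \<in> parcs G' \<and> (x, u) \<in> parcs G'" "x \<in> pverts G'"
    and y: "y = v \<or> (v, y) \<in> parcs G' \<and> (y, v) \<in> parcs G'"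
  shows "hitting_time G' x y \<le> 15 * hitting_time G u v + 2 * of_nat (card (parcs G'))"
proof -
  let ?A = "of_nat (card (parcs G')) :: ennreal"
  have "hitting_time G' x y \<le> hitting_time G' x u + hitting_time G' u y"
    using x by (intro step.hitting_time_triangle)
  also have "\<dots> \<le> hitting_time G' x u + (hitting_time G' u v + hitting_time G' v y)"
    using uv by (intro add_left_mono step.hitting_time_triangle old_in_verts')
  also have "\<dots> \<le> ?A + (15 * hitting_time G u v + ?A)"
    using hitting_time_decimation[OF uv(2) fin uv(1)] uv
    by (intro add_mono hitting_time_child_le[OF x(1)] hitting_time_child_le[OF y]) auto
  finally show ?thesis by (simp add: mult_2 ac_simps)
qed

text \<open>The same detour with the roles exchanged: from \<open>u\<close> through \<open>x\<close>
  and \<open>y\<close> to \<open>v\<close>.\<close>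

lemma hitting_time_children_ge:
  assumes fin: "\<And>u v. u \<in> pverts G \<Longrightarrow> v \<in> pverts G \<Longrightarrow> hitting_time G u v < \<infinity>"
    and uv: "u \<in> pverts G" "v \<in> pverts G"
    and x: "x = u \<or> (u, x) \<in> parcs G' \<and> (x, u) \<in> parcs G'" "x \<in> pverts G'"
    and y: "y = v \<or> (v, y) \<in> parcs G' \<and> (y, v) \<in> parcs G'"
  shows "15 * hitting_time G u v \<le> hitting_time G' x y + 2 * of_nat (card (parcs G'))"
proof -
  let ?A = "of_nat (card (parcs G')) :: ennreal"
  have "15 * hitting_time G u v = hitting_time G' u v"
    using hitting_time_decimation[OF uv(2) fin uv(1)] uv by simp
  also have "\<dots> \<le> hitting_time G' u x + hitting_time G' x v"
    using uv by (intro step.hitting_time_triangle old_in_verts')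
  also have "\<dots> \<le> hitting_time G' u x + (hitting_time G' x y + hitting_time G' y v)"
    using x by (intro add_left_mono step.hitting_time_triangle)
  also have "\<dots> \<le> ?A + (hitting_time G' x y + ?A)"
    by (intro add_mono hitting_time_child_le[OF x(1)] hitting_time_child_le[OF y] order_refl)
  finally show ?thesis by (simp add: mult_2 ac_simps)
qed

text \<open>Including the arc count \<open>A\<close> in the bound makes it inductive: the new count
  is \<open>5 * A\<close>, and the error \<open>2 * 5 * A\<close> plus the new count is exactly
  \<open>15 * A\<close>.\<close>

lemma hitting_time_upper_step:
  assumes le: "\<And>u v. u \<in> pverts G \<Longrightarrow> v \<in> pverts G \<Longrightarrow>
      hitting_time G u v + of_nat (card (parcs G)) \<le> ennreal B"
    and "0 \<le> B" "x \<in> pverts G'" "y \<in> pverts G'"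
  shows "hitting_time G' x y + of_nat (card (parcs G')) \<le> ennreal (15 * B)"
proof -
  have fin: "hitting_time G u v < \<infinity>" if "u \<in> pverts G" "v \<in> pverts G" for u v
  proof -
    have "hitting_time G u v \<le> hitting_time G u v + of_nat (card (parcs G))" by simp
    also have "\<dots> \<le> ennreal B" by (rule le[OF that])
    also have "\<dots> < \<infinity>" by simp
    finally show ?thesis .
  qed
  obtain u where u: "u \<in> pverts G" "x = u \<or> (u, x) \<in> parcs G' \<and> (x, u) \<in> parcs G'"
    using assms(3) children_parent[of x "pverts G"] unfolding children_verts by blast
  obtain v where v: "v \<in> pverts G" "y = v \<or> (v, y) \<in> parcs G' \<and> (y, v) \<in> parcs G'"
    using assms(4) children_parent[of y "pverts G"] unfolding children_verts by blast
  have "hitting_time G' x y + of_nat (card (parcs G')) \<le>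
      15 * hitting_time G u v + 2 * of_nat (card (parcs G')) + of_nat (card (parcs G'))"
    by (intro add_right_mono hitting_time_children_le fin u v assms(3))
  also have "\<dots> = 15 * hitting_time G u v + 3 * of_nat (card (parcs G'))"
    by (simp only: add.assoc ennreal_mult_3)
  also have "\<dots> = 15 * (hitting_time G u v + of_nat (card (parcs G)))"
    by (simp add: card_arcs' distrib_left mult.assoc[symmetric])
  also have "\<dots> \<le> 15 * ennreal B"
    by (intro mult_left_mono le u v) simp
  finally show ?thesis using \<open>0 \<le> B\<close> by (simp add: ennreal_mult)
qed

text \<open>Here the arc count \<open>A\<close> is a reserve: of the \<open>15 * A\<close> gained by
  scaling, the error uses \<open>10 * A\<close>, and the remaining \<open>5 * A\<close> is the new
  arc count.\<close>

lemma hitting_time_lower_step: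
  assumes fin: "\<And>u v. u \<in> pverts G \<Longrightarrow> v \<in> pverts G \<Longrightarrow> hitting_time G u v < \<infinity>"
    and XY: "X \<subseteq> pverts G" "Y \<subseteq> pverts G"
    and ge: "\<And>u v. u \<in> X \<Longrightarrow> v \<in> Y \<Longrightarrow>
      ennreal B + of_nat (card (parcs G)) \<le> hitting_time G u v"
    and "0 \<le> B" "x \<in> children X" "y \<in> children Y"
  shows "ennreal (15 * B) + of_nat (card (parcs G')) \<le> hitting_time G' x y"
proof -
  obtain u where u: "u \<in> X" "x = u \<or> (u, x) \<in> parcs G' \<and> (x, u) \<in> parcs G'"
    using children_parent[OF assms(6) XY(1)] by blast
  obtain v where v: "v \<in> Y" "y = v \<or> (v, y) \<in> parcs G' \<and> (y, v) \<in> parcs G'"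
    using children_parent[OF assms(7) XY(2)] by blast
  have x: "x \<in> pverts G'"
    using children_mono[OF XY(1)] assms(6) unfolding children_verts by blast
  \<comment> \<open>The error is added on both sides, and cancelled at the end by its finiteness, to
    avoid truncated subtraction.\<close>
  have "2 * of_nat (card (parcs G')) + (ennreal (15 * B) + of_nat (card (parcs G'))) =
      15 * ennreal B + 3 * of_nat (card (parcs G'))"
    using \<open>0 \<le> B\<close> by (simp add: ennreal_mult add.left_commute ennreal_mult_3)
  also have "\<dots> = 15 * (ennreal B + of_nat (card (parcs G)))"
    by (simp add: card_arcs' distrib_left mult.assoc[symmetric])
  also have "\<dots> \<le> 15 * hitting_time G u v"
    by (intro mult_left_mono ge u v) simp
  also have "\<dots> \<le> hitting_time G' x y + 2 * of_nat (card (parcs G'))"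
    using u v XY by (intro hitting_time_children_ge fin x) auto
  finally have "2 * of_nat (card (parcs G')) + (ennreal (15 * B) + of_nat (card (parcs G'))) \<le>
      2 * of_nat (card (parcs G')) + hitting_time G' x y"
    by (simp only: add.commute)
  moreover have "2 * of_nat (card (parcs G')) \<noteq> (top :: ennreal)"
    by (simp add: ennreal_mult_eq_top_iff)
  ultimately show ?thesis by (simp only: ennreal_add_left_cancel_le) simp
qed

end

section \<open>From trees to walk graphs\<close>

lemma finite_tree_walk_graph:
  assumes "finite_tree G" "2 \<le> card (pverts G)"
  shows "walk_graph G" and "u \<in> pverts G \<Longrightarrow> v \<in> pverts G \<Longrightarrow> (u, v) \<in> (parcs G)\<^sup>*"
proof -
  interpret pair_graph G using assms(1) by (simp add: finite_tree_def)
  have sym: "sym (parcs G)"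
    using pair_sym_arcs by (simp add: symmetric_def)
  have "(u, v) \<in> rtrancl_on (pverts G) ((parcs G)\<^sup>s)" if "u \<in> pverts G" "v \<in> pverts G" for u v
    using assms(1) that unfolding finite_tree_def connected_conv by simp
  moreover have "(parcs G)\<^sup>s = parcs G"
    using sym by (auto simp: symcl_def sym_def)
  ultimately have reach: "(u, v) \<in> (parcs G)\<^sup>*" if "u \<in> pverts G" "v \<in> pverts G" for u v
    using that rtrancl_on_rtranclI by metis
  then show "u \<in> pverts G \<Longrightarrow> v \<in> pverts G \<Longrightarrow> (u, v) \<in> (parcs G)\<^sup>*" .
  show "walk_graph G"
  proof
    show "finite (pverts G)" by (rule pair_finite_verts)
    show "parcs G \<subseteq> pverts G \<times> pverts G" using in_arcsD1 in_arcsD2 by auto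
    show "(w, u) \<in> parcs G" if "(u, w) \<in> parcs G" for u w using sym that by (rule symD)
    show "(u, u) \<notin> parcs G" for u using pair_no_loops[of "(u, u)"] by auto
    show "nbrs G u \<noteq> {}" if "u \<in> pverts G" for u
    proof -
      \<comment> \<open>A second vertex exists and is reachable from \<open>u\<close>; the first arc
        of a path to it provides a neighbour.\<close>
      have "\<not> pverts G \<subseteq> {u}"
        using assms(2) card_mono[of "{u}" "pverts G"] by auto
      then obtain v where "v \<in> pverts G" "v \<noteq> u" by blast
      then have "(u, v) \<in> (parcs G)\<^sup>*" "u \<noteq> v" using reach that by auto
      then show ?thesis by (auto simp: nbrs_def elim: converse_rtranclE)
    qed
  qed
qed

section \<open>The sequence of graphs\<close>

lemma ennreal_add_leD: "a + b \<le> c \<Longrightarrow> a \<le> (c :: ennreal)"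
  using order_trans[of a "a + b" c] by simp

locale algorithm_I_sequence =
  fixes T :: "nat \<Rightarrow> 'a pair_pre_digraph"
  assumes tree: "finite_tree (T 0)" and two_le: "2 \<le> card (pverts (T 0))"
    and step: "algorithm_I_step (T t) (T (Suc t))"
begin

abbreviation "V t \<equiv> pverts (T t)"
abbreviation "A0 \<equiv> card (parcs (T 0))"

lemma walk_graph_T: "walk_graph (T t)"
proof (induction t)
  case 0
  then show ?case using finite_tree_walk_graph(1)[OF tree two_le] .
next
  case (Suc t)
  then obtain ins lf where "algorithm_I (T t) (T (Suc t)) ins lf"
    using step by (rule algorithm_I_stepE)
  then interpret algorithm_I "T t" "T (Suc t)" ins lf .
  show ?case by (rule step.walk_graph_axioms)
qed

lemma algorithm_I_T:
  obtains ins lf where "algorithm_I (T t) (T (Suc t)) ins lf"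
  using walk_graph_T step by (rule algorithm_I_stepE)

section \<open>Growth of the numbers of arcs and vertices\<close>

lemma card_arcs_T: "card (parcs (T t)) = A0 * 5 ^ t"
proof (induction t)
  case (Suc t)
  obtain ins lf where "algorithm_I (T t) (T (Suc t)) ins lf" by (rule algorithm_I_T)
  then interpret algorithm_I "T t" "T (Suc t)" ins lf .
  show ?case using Suc card_arcs' by simp
qed simp

text \<open>The geometric sum of the increments \<open>2 * A0 * 5 ^ i\<close>, written without
  subtraction or division.\<close>

lemma card_verts_T: "2 * card (V t) + A0 = 2 * card (V 0) + A0 * 5 ^ t"
proof (induction t)
  case (Suc t)
  obtain ins lf where "algorithm_I (T t) (T (Suc t)) ins lf" by (rule algorithm_I_T)
  then interpret algorithm_I "T t" "T (Suc t)" ins lf .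
  show ?case using Suc card_verts' card_arcs_T[of t] by simp
qed simp

lemma verts_mono: "V 0 \<subseteq> V t"
proof (induction t)
  case (Suc t)
  obtain ins lf where "algorithm_I (T t) (T (Suc t)) ins lf" by (rule algorithm_I_T)
  then interpret algorithm_I "T t" "T (Suc t)" ins lf .
  show ?case using Suc old_in_verts' by blast
qed simp

lemma two_le_arcs: "2 \<le> A0"
proof -
  interpret walk_graph "T 0" by (rule walk_graph_T)
  have "card (V 0) \<le> (\<Sum>u\<in>V 0. card (nbrs (T 0) u))"
    using sum_mono[of "V 0" "\<lambda>_. 1" "\<lambda>u. card (nbrs (T 0) u)"] deg_pos by (simp add: Suc_le_eq)
  then show ?thesis using two_le by (simp add: sum_deg)
qed

lemma card_verts_lower: "5 ^ t \<le> card (V t)"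
proof -
  have "A0 * (5 ^ t - 1) \<ge> 2 * (5 ^ t - 1)"
    using two_le_arcs by (rule mult_right_mono) simp
  moreover have "A0 * 5 ^ t = A0 + A0 * (5 ^ t - 1)"
    by (simp add: diff_mult_distrib2)
  ultimately show ?thesis using card_verts_T[of t] two_le by linarith
qed

lemma card_verts_upper: "card (V t) \<le> (card (V 0) + A0) * 5 ^ t"
proof -
  have "card (V 0) \<le> card (V 0) * 5 ^ t" by simp
  then show ?thesis using card_verts_T[of t] unfolding distrib_right by linarith
qed

section \<open>Hitting times of order \<open>15 ^ t\<close>\<close>

lemma hitting_time_T_finite:
  assumes "u \<in> V t" "v \<in> V t"
  shows "hitting_time (T t) u v < \<infinity>"
  using assms
proof (induction t arbitrary: u v)
  case 0
  interpret walk_graph "T 0" by (rule walk_graph_T)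
  show ?case
    using 0 by (intro hitting_time_rtrancl_finite finite_tree_walk_graph(2)[OF tree two_le])
next
  case (Suc t)
  obtain ins lf where "algorithm_I (T t) (T (Suc t)) ins lf" by (rule algorithm_I_T)
  then interpret algorithm_I "T t" "T (Suc t)" ins lf .
  \<comment> \<open>Decimation needs an old target, so a target \<open>v\<close> that may be new is
    reached through its parent \<open>w\<close>.\<close>
  obtain w where w: "w \<in> V t" "v = w \<or> (w, v) \<in> parcs (T (Suc t)) \<and> (v, w) \<in> parcs (T (Suc t))"
    using children_parent[of v "V t"] Suc.prems unfolding children_verts by blast
  have "hitting_time (T (Suc t)) u v \<le> hitting_time (T (Suc t)) u w + hitting_time (T (Suc t)) w v"
    by (intro step.hitting_time_triangle Suc.prems)
  also have "\<dots> \<le> hitting_time (T (Suc t)) u w + of_nat (card (parcs (T (Suc t))))"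
    by (intro add_left_mono hitting_time_child_le[OF w(2)])
  also have "\<dots> < \<infinity>"
    using hitting_time_step_finite[OF w(1) _ Suc.prems(1)] Suc.IH w(1)
    by (simp add: ennreal_of_nat_eq_real_of_nat)
  finally show ?case .
qed

lemma hitting_time_T_upper:
  obtains B where "0 \<le> B" "\<And>t u v. u \<in> V t \<Longrightarrow> v \<in> V t \<Longrightarrow> hitting_time (T t) u v \<le> ennreal (B * 15 ^ t)"
proof -
  interpret G0: walk_graph "T 0" by (rule walk_graph_T)
  \<comment> \<open>The sum dominates each single hitting time, and the extra arc count gives the
    base case of the invariant in \<open>hitting_time_upper_step\<close>.\<close>
  define S where "S = (\<Sum>u\<in>V 0. \<Sum>v\<in>V 0. hitting_time (T 0) u v) + of_nat A0"
  have "S < \<infinity>"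
    unfolding S_def using G0.finite_verts hitting_time_T_finite[of _ 0]
    by (simp add: ennreal_of_nat_eq_real_of_nat)
  then obtain B where B: "0 \<le> B" "S = ennreal B" by (cases S) auto
  have "hitting_time (T t) u v + of_nat (card (parcs (T t))) \<le> ennreal (B * 15 ^ t)"
    if "u \<in> V t" "v \<in> V t" for t u v
    using that
  proof (induction t arbitrary: u v)
    case 0
    have "hitting_time (T 0) u v \<le> (\<Sum>v\<in>V 0. hitting_time (T 0) u v)"
      using 0 G0.finite_verts by (intro member_le_sum) auto
    also have "\<dots> \<le> (\<Sum>u\<in>V 0. \<Sum>v\<in>V 0. hitting_time (T 0) u v)"
      using 0 G0.finite_verts by (intro member_le_sum[of u]) auto
    finally show ?case by (simp add: S_def flip: B(2))
  next
    case (Suc t)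
    obtain ins lf where "algorithm_I (T t) (T (Suc t)) ins lf" by (rule algorithm_I_T)
    then interpret algorithm_I "T t" "T (Suc t)" ins lf .
    show ?case
      using hitting_time_upper_step[OF Suc.IH _ Suc.prems] B(1) by (simp add: mult.left_commute)
  qed
  then have "hitting_time (T t) u v \<le> ennreal (B * 15 ^ t)" if "u \<in> V t" "v \<in> V t" for t u v
    using that by (blast intro: ennreal_add_leD)
  with B(1) show thesis by (rule that)
qed

lemma hitting_time_T_old:
  assumes "u \<in> V 0" "v \<in> V 0"
  shows "hitting_time (T t) u v = 15 ^ t * hitting_time (T 0) u v"
proof (induction t)
  case (Suc t)
  obtain ins lf where "algorithm_I (T t) (T (Suc t)) ins lf" by (rule algorithm_I_T)
  then interpret algorithm_I "T t" "T (Suc t)" ins lf .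
  have "hitting_time (T (Suc t)) u v = 15 * hitting_time (T t) u v"
    using assms verts_mono[of t] by (intro hitting_time_decimation hitting_time_T_finite) auto
  then show ?case by (simp add: Suc mult.assoc)
qed simp

text \<open>From a stage \<open>s\<close> on at which \<open>15 ^ s\<close> exceeds twice the number \<open>A0 * 5 ^ s\<close> of arcs, the
  descendants of two fixed original vertices stay far apart: the error made by moving to a
  neighbour grows only like \<open>5 ^ t\<close>.  The degree sums make the induction work, because a set
  with degree sum \<open>d\<close> has \<open>2 * d\<close> new children, of total degree \<open>5 * d\<close> with the set itself.\<close>

lemma hitting_time_T_lower:
  obtains s where "\<And>t. s \<le> t \<Longrightarrow> \<exists>X Y. X \<subseteq> V t \<and> Y \<subseteq> V t \<and>
    5 ^ (t - s) \<le> 5 * card X \<and> 5 ^ (t - s) \<le> 5 * card Y \<and>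
    (\<forall>x\<in>X. \<forall>y\<in>Y. ennreal (15 ^ t / 2) \<le> hitting_time (T t) x y)"
proof -
  obtain a b where ab: "a \<in> V 0" "b \<in> V 0" "a \<noteq> b"
    using two_le by (metis card_2_iff' card_le_Suc_iff ex_card insertI1 numeral_2_eq_2 subset_iff)
  obtain s where "real (2 * A0) < 3 ^ s"
    using real_arch_pow[of 3 "real (2 * A0)"] by auto
  then have s: "2 * real A0 \<le> 3 ^ s" by simp
  \<comment> \<open>Two strengthenings make this inductive: the arc count is the reserve needed by
    \<open>hitting_time_lower_step\<close>, and the degree sums grow by exactly 5. The factor in
    \<open>5 * card X\<close> covers a lag, as the size of \<open>children X\<close> is bounded by
    the degree sum one stage earlier.\<close>
  have inv: "\<exists>X Y. X \<subseteq> V t \<and> Y \<subseteq> V t \<and>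
    5 ^ (t - s) \<le> 5 * card X \<and> 5 ^ (t - s) \<le> 5 * card Y \<and>
    5 ^ (t - s) \<le> (\<Sum>x\<in>X. card (nbrs (T t) x)) \<and> 5 ^ (t - s) \<le> (\<Sum>y\<in>Y. card (nbrs (T t) y)) \<and>
    (\<forall>x\<in>X. \<forall>y\<in>Y. ennreal (15 ^ t / 2) + of_nat (card (parcs (T t))) \<le> hitting_time (T t) x y)"
    if "s \<le> t" for t
    using that
  proof (induction rule: dec_induct)
    case base
    interpret walk_graph "T s" by (rule walk_graph_T)
    have abs: "a \<in> V s" "b \<in> V s" using ab verts_mono[of s] by auto
    have "(15::real) ^ s = 3 ^ s * 5 ^ s" by (simp flip: power_mult_distrib)
    then have "2 * real A0 * 5 ^ s \<le> 15 ^ s"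
      using mult_right_mono[OF s, of "5 ^ s"] by simp
    then have "ennreal (15 ^ s / 2 + real (A0 * 5 ^ s)) \<le> ennreal (15 ^ s)"
      by (intro ennreal_leI) simp
    moreover have "ennreal (15 ^ s / 2 + real (A0 * 5 ^ s)) = ennreal (15 ^ s / 2) + ennreal (real (A0 * 5 ^ s))"
      by (rule ennreal_plus) simp_all
    ultimately have "ennreal (15 ^ s / 2) + of_nat (card (parcs (T s))) \<le> ennreal (15 ^ s)"
      by (simp only: card_arcs_T[of s] ennreal_of_nat_eq_real_of_nat)
    also have "\<dots> = 15 ^ s * 1" by (simp flip: ennreal_power)
    \<comment> \<open>Distinct original vertices are at hitting time at least 1 at stage 0, hence at
      least \<open>15 ^ s\<close> at stage \<open>s\<close>.\<close>
    also have "\<dots> \<le> hitting_time (T s) a b"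
      unfolding hitting_time_T_old[OF ab(1,2), of s]
      using walk_graph.hitting_time_ge_1[OF walk_graph_T[of 0] ab(3)] by (intro mult_left_mono) auto
    finally show ?case
      using abs deg_pos[of a] deg_pos[of b] by - (rule exI[of _ "{a}"], rule exI[of _ "{b}"], simp)
  next
    case (step t)
    then obtain X Y where X: "X \<subseteq> V t" "5 ^ (t - s) \<le> (\<Sum>x\<in>X. card (nbrs (T t) x))"
      and Y: "Y \<subseteq> V t" "5 ^ (t - s) \<le> (\<Sum>y\<in>Y. card (nbrs (T t) y))"
      and XY: "\<And>x y. x \<in> X \<Longrightarrow> y \<in> Y \<Longrightarrow>
        ennreal (15 ^ t / 2) + of_nat (card (parcs (T t))) \<le> hitting_time (T t) x y"
      by blast
    obtain ins lf where "algorithm_I (T t) (T (Suc t)) ins lf" by (rule algorithm_I_T)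
    then interpret algorithm_I "T t" "T (Suc t)" ins lf .
    have "ennreal (15 ^ Suc t / 2) + of_nat (card (parcs (T (Suc t)))) \<le> hitting_time (T (Suc t)) x y"
      if "x \<in> children X" "y \<in> children Y" for x y
      using hitting_time_lower_step[OF hitting_time_T_finite X(1) Y(1) XY _ that] by simp
    moreover have "(5 :: nat) ^ (Suc t - s) = 5 * 5 ^ (t - s)"
      using step by (simp add: Suc_diff_le)
    moreover have "children X \<subseteq> V (Suc t)" "children Y \<subseteq> V (Suc t)"
      using children_mono X(1) Y(1) unfolding children_verts[symmetric] by blast+
    ultimately show ?case
      using X Y by - (rule exI[of _ "children X"], rule exI[of _ "children Y"],
          simp add: card_children degree_sum_children)
  qed
  have "\<exists>X Y. X \<subseteq> V t \<and> Y \<subseteq> V t \<and>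
    5 ^ (t - s) \<le> 5 * card X \<and> 5 ^ (t - s) \<le> 5 * card Y \<and>
    (\<forall>x\<in>X. \<forall>y\<in>Y. ennreal (15 ^ t / 2) \<le> hitting_time (T t) x y)" if st: "s \<le> t" for t
  proof -
    obtain X Y where "X \<subseteq> V t" "Y \<subseteq> V t" "5 ^ (t - s) \<le> 5 * card X" "5 ^ (t - s) \<le> 5 * card Y"
      and XY: "\<And>x y. x \<in> X \<Longrightarrow> y \<in> Y \<Longrightarrow>
        ennreal (15 ^ t / 2) + of_nat (card (parcs (T t))) \<le> hitting_time (T t) x y"
      using inv[OF st] by blast
    moreover have "\<forall>x\<in>X. \<forall>y\<in>Y. ennreal (15 ^ t / 2) \<le> hitting_time (T t) x y"
      by (intro ballI ennreal_add_leD[OF XY])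
    ultimately show ?thesis by blast
  qed
  then show thesis by (rule that)
qed

section \<open>Bounds on the mean hitting time\<close>

lemma mean_hitting_time_T_upper:
  obtains B where "0 < B" "\<And>t. mean_hitting_time (T t) \<le> ennreal (B * 15 ^ t)"
proof -
  obtain B where B: "0 \<le> B" "\<And>t u v. u \<in> V t \<Longrightarrow> v \<in> V t \<Longrightarrow> hitting_time (T t) u v \<le> ennreal (B * 15 ^ t)"
    by (rule hitting_time_T_upper) blast
  \<comment> \<open>The factor 2 comes from \<open>n \<le> 2 * (n - 1)\<close> when the
    \<open>n * n\<close> terms are divided by \<open>n * (n - 1)\<close>; the added 1 makes the
    constant positive even if \<open>B = 0\<close>.\<close>
  have "mean_hitting_time (T t) \<le> ennreal ((2 * B + 1) * 15 ^ t)" for t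
  proof -
    define n where "n = card (V t)"
    have n: "2 \<le> n"
      using two_le card_mono[OF walk_graph.finite_verts[OF walk_graph_T] verts_mono, of t]
      unfolding n_def by simp
    have "(\<Sum>u\<in>V t. \<Sum>v\<in>V t. hitting_time (T t) u v) \<le> (\<Sum>u\<in>V t. \<Sum>v\<in>V t. ennreal (B * 15 ^ t))"
      by (intro sum_mono B(2))
    also have "\<dots> = ennreal (real n * (real n * (B * 15 ^ t)))"
      using B(1) by (simp add: n_def ennreal_mult ennreal_of_nat_eq_real_of_nat)
    finally have "mean_hitting_time (T t) \<le>
        ennreal (real n * (real n * (B * 15 ^ t))) / ennreal (real (n * (n - 1)))"
      unfolding mean_hitting_time_def n_def[symmetric] ennreal_of_nat_eq_real_of_nat
      by (rule divide_right_mono_ennreal)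
    also have "\<dots> = ennreal (real n * (real n * (B * 15 ^ t)) / real (n * (n - 1)))"
      using n B(1) by (intro divide_ennreal) auto
    also have "\<dots> \<le> ennreal ((2 * B + 1) * 15 ^ t)"
    proof (rule ennreal_leI)
      define m where "m = real (n - 1)"
      have m: "0 < m" "real n \<le> 2 * m" using n by (simp_all add: m_def)
      have "real n * (B * 15 ^ t) \<le> 2 * m * (B * 15 ^ t)"
        using B(1) m by (intro mult_right_mono) auto
      then have "real n * (B * 15 ^ t) / m \<le> 2 * B * 15 ^ t"
        using m by (subst pos_divide_le_eq) (auto simp: mult_ac)
      moreover have "real n * (real n * (B * 15 ^ t)) / real (n * (n - 1)) = real n * (B * 15 ^ t) / m"
        using n unfolding of_nat_mult m_def[symmetric] by (subst mult_divide_mult_cancel_left) auto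
      ultimately have "real n * (real n * (B * 15 ^ t)) / real (n * (n - 1)) \<le> 2 * B * 15 ^ t"
        by simp
      then show "real n * (real n * (B * 15 ^ t)) / real (n * (n - 1)) \<le> (2 * B + 1) * 15 ^ t"
        by (simp add: distrib_right add_increasing2)
    qed
    finally show ?thesis .
  qed
  with B(1) show thesis by (intro that[of "2 * B + 1"]) auto
qed

lemma mean_hitting_time_T_lower:
  obtains b s where "0 < b" "\<And>t. s \<le> t \<Longrightarrow> ennreal (b * 15 ^ t) \<le> mean_hitting_time (T t)"
proof -
  obtain s where s: "\<And>t. s \<le> t \<Longrightarrow> \<exists>X Y. X \<subseteq> V t \<and> Y \<subseteq> V t \<and>
    5 ^ (t - s) \<le> 5 * card X \<and> 5 ^ (t - s) \<le> 5 * card Y \<and>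
    (\<forall>x\<in>X. \<forall>y\<in>Y. ennreal (15 ^ t / 2) \<le> hitting_time (T t) x y)"
    by (rule hitting_time_T_lower) blast
  define K where "K = real (card (V 0) + A0)"
  have K: "0 < K" using two_le by (simp add: K_def)
  define d where "d = (1 / 5 ^ Suc s :: real)"
  have d: "0 < d" by (simp add: d_def)
  \<comment> \<open>At least \<open>(d * 5 ^ t)^2\<close> ordered pairs from \<open>X\<close> and
    \<open>Y\<close> contribute \<open>15 ^ t / 2\<close> each, against at most
    \<open>(K * 5 ^ t)^2\<close> pairs in the denominator.\<close>
  have "ennreal (d * d / (2 * K * K) * 15 ^ t) \<le> mean_hitting_time (T t)" if t: "s \<le> t" for t
  proof -
    interpret walk_graph "T t" by (rule walk_graph_T)
    obtain X Y where X: "X \<subseteq> V t" "5 ^ (t - s) \<le> 5 * card X"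
      and Y: "Y \<subseteq> V t" "5 ^ (t - s) \<le> 5 * card Y"
      and XY: "\<And>x y. x \<in> X \<Longrightarrow> y \<in> Y \<Longrightarrow> ennreal (15 ^ t / 2) \<le> hitting_time (T t) x y"
      using s[OF t] by blast
    have fin: "finite X" "finite Y" using X Y finite_verts finite_subset by blast+
    have large: "d * 5 ^ t \<le> real m" if "5 ^ (t - s) \<le> 5 * m" for m
    proof -
      have "real (5 ^ (t - s)) \<le> real (5 * m)" using that by (rule of_nat_mono)
      moreover have "d * 5 ^ t = 5 ^ (t - s) / 5"
        using t by (simp add: d_def power_diff)
      ultimately show ?thesis by simp
    qed
    define n where "n = card (V t)"
    have n: "2 \<le> n"
      using two_le card_mono[OF finite_verts verts_mono] unfolding n_def by simp
    have nK: "real n \<le> K * 5 ^ t"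
      using of_nat_mono[OF card_verts_upper[of t], where 'a = real] by (simp add: n_def K_def)
    have double_sum: "(\<Sum>x\<in>X. \<Sum>y\<in>Y. ennreal z) = ennreal (real (card X) * real (card Y) * z)"
      if "0 \<le> z" for z
      using that by (simp add: ennreal_mult ennreal_of_nat_eq_real_of_nat mult.assoc)
    have "d * 5 ^ t * (d * 5 ^ t) * (15 ^ t / 2) \<le> real (card X) * real (card Y) * (15 ^ t / 2)"
      using large[OF X(2)] large[OF Y(2)] d by (intro mult_right_mono mult_mono) auto
    then have "ennreal (d * 5 ^ t * (d * 5 ^ t) * (15 ^ t / 2)) \<le>
        ennreal (real (card X) * real (card Y) * (15 ^ t / 2))"
      by (rule ennreal_leI)
    also have "\<dots> = (\<Sum>x\<in>X. \<Sum>y\<in>Y. ennreal (15 ^ t / 2))"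
      by (rule double_sum[symmetric]) simp
    also have "\<dots> \<le> (\<Sum>x\<in>X. \<Sum>y\<in>Y. hitting_time (T t) x y)"
      by (intro sum_mono XY)
    also have "\<dots> \<le> (\<Sum>x\<in>X. \<Sum>y\<in>V t. hitting_time (T t) x y)"
      by (intro sum_mono sum_mono2 finite_verts Y) simp
    also have "\<dots> \<le> (\<Sum>x\<in>V t. \<Sum>y\<in>V t. hitting_time (T t) x y)"
      by (intro sum_mono2 finite_verts X) simp
    finally have mean: "ennreal (d * 5 ^ t * (d * 5 ^ t) * (15 ^ t / 2)) / ennreal (real (n * (n - 1))) \<le>
        mean_hitting_time (T t)"
      unfolding mean_hitting_time_def n_def[symmetric] ennreal_of_nat_eq_real_of_nat
      by (rule divide_right_mono_ennreal)
    have quot: "ennreal (d * 5 ^ t * (d * 5 ^ t) * (15 ^ t / 2)) / ennreal (real (n * (n - 1))) =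
        ennreal (d * 5 ^ t * (d * 5 ^ t) * (15 ^ t / 2) / real (n * (n - 1)))"
      using n d by (intro divide_ennreal) auto
    have "d * d / (2 * K * K) * 15 ^ t \<le> d * 5 ^ t * (d * 5 ^ t) * (15 ^ t / 2) / real (n * (n - 1))"
    proof -
      have "real (n * (n - 1)) \<le> real n * real n" by (simp flip: of_nat_mult)
      also have "\<dots> \<le> K * 5 ^ t * (K * 5 ^ t)" using nK by (intro mult_mono) auto
      finally have "d * 5 ^ t * (d * 5 ^ t) * (15 ^ t / 2) / (K * 5 ^ t * (K * 5 ^ t)) \<le>
          d * 5 ^ t * (d * 5 ^ t) * (15 ^ t / 2) / real (n * (n - 1))"
        using n d K by (intro divide_left_mono) auto
      then show ?thesis using K by (simp add: field_simps)
    qed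
    then show ?thesis by (rule order_trans[OF ennreal_leI mean[unfolded quot]])
  qed
  moreover have "0 < d * d / (2 * K * K)" using d K by simp
  ultimately show thesis using that by blast
qed

end

text \<open>The exponent is the logarithm of 15 to base 5, which converts vertex counts of order
  \<open>5 ^ t\<close> into times of order \<open>15 ^ t\<close>.\<close>

lemma five_power_powr:
  "(5 ^ t) powr (1 + ln 3 / ln 5) = (15 ^ t :: real)"
proof -
  have "(5 ^ t :: real) powr (ln 3 / ln 5) = exp (ln 3 / ln 5 * (real t * ln 5))"
    by (simp add: powr_def ln_realpow)
  also have "\<dots> = exp (real t * ln 3)" by simp
  also have "\<dots> = 3 ^ t" by (simp add: exp_of_nat_mult)
  finally show ?thesis by (simp add: powr_add flip: power_mult_distrib)
qed

theorem mainTheorem5: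
  fixes T :: "nat \<Rightarrow> 'a pair_pre_digraph"
  assumes "finite_tree (T 0)"
    and "2 \<le> card (pverts (T 0))"
    and "\<And>t. algorithm_I_step (T t) (T (Suc t))"
  shows "\<exists>c C :: real. 0 < c \<and> c \<le> C \<and>
    (\<forall>\<^sub>F t in sequentially.
       ennreal (c * real (card (pverts (T t))) powr (1 + ln 3 / ln 5)) \<le> mean_hitting_time (T t) \<and>
       mean_hitting_time (T t) \<le> ennreal (C * real (card (pverts (T t))) powr (1 + ln 3 / ln 5)))"
proof -
  interpret algorithm_I_sequence T using assms by unfold_locales
  let ?\<chi> = "1 + ln 3 / ln 5 :: real"
  obtain B where B: "0 < B" "\<And>t. mean_hitting_time (T t) \<le> ennreal (B * 15 ^ t)"
    by (rule mean_hitting_time_T_upper) blast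
  obtain b s where b: "0 < b" "\<And>t. s \<le> t \<Longrightarrow> ennreal (b * 15 ^ t) \<le> mean_hitting_time (T t)"
    by (rule mean_hitting_time_T_lower) blast
  define K where "K = real (card (V 0) + A0)"
  have K: "0 < K" using two_le by (simp add: K_def)
  \<comment> \<open>Since there are at most \<open>K * 5 ^ t\<close> vertices, their power is at
    most \<open>K powr ?\<chi> * 15 ^ t\<close>; dividing \<open>b\<close> by this factor absorbs
    it.\<close>
  define c where "c = b / K powr ?\<chi>"
  have c: "0 < c" using b K by (simp add: c_def)
  \<comment> \<open>There are at least \<open>5 ^ t\<close> vertices, so \<open>B\<close> already
    serves as a constant; the maximum with \<open>c\<close> secures the required order of the two
    constants.\<close>
  have upper: "mean_hitting_time (T t) \<le> ennreal (max B c * real (card (V t)) powr ?\<chi>)" for t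
  proof -
    have "15 ^ t \<le> real (card (V t)) powr ?\<chi>"
      using of_nat_mono[OF card_verts_lower[of t], where 'a = real]
      unfolding five_power_powr[symmetric] by (intro powr_mono2) auto
    then have "B * 15 ^ t \<le> max B c * real (card (V t)) powr ?\<chi>"
      using B(1) by (intro mult_mono) auto
    then show ?thesis using B(2)[of t] by (meson ennreal_leI order_trans)
  qed
  have lower: "ennreal (c * real (card (V t)) powr ?\<chi>) \<le> mean_hitting_time (T t)" if "s \<le> t" for t
  proof -
    have "real (card (V t)) \<le> K * 5 ^ t"
      using of_nat_mono[OF card_verts_upper[of t], where 'a = real] by (simp add: K_def)
    then have "real (card (V t)) powr ?\<chi> \<le> (K * 5 ^ t) powr ?\<chi>"
      by (intro powr_mono2) auto
    also have "\<dots> = K powr ?\<chi> * 15 ^ t"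
      unfolding five_power_powr[symmetric] by (rule powr_mult)
    finally have "c * real (card (V t)) powr ?\<chi> \<le> c * (K powr ?\<chi> * 15 ^ t)"
      using c by (intro mult_left_mono) auto
    also have "\<dots> = b * 15 ^ t" using K by (simp add: c_def)
    finally show ?thesis using b(2)[OF that] by (meson ennreal_leI order_trans)
  qed
  have "\<forall>\<^sub>F t in sequentially.
      ennreal (c * real (card (V t)) powr ?\<chi>) \<le> mean_hitting_time (T t) \<and>
      mean_hitting_time (T t) \<le> ennreal (max B c * real (card (V t)) powr ?\<chi>)"
    using eventually_ge_at_top[of s] by (rule eventually_mono) (use upper lower in blast)
  with c show ?thesis by - (rule exI[of _ c], rule exI[of _ "max B c"], auto)
qed

end
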